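(* Let $\mathbb{F}$ be a field of characteristic $0$, let $A\neq 0$ be an abelian group, and let $\partial: A\to\mathbb{F}$ be an additive map with $\partial(x)\ne 0$ for all $x\ne 0$. Set $$\mathfrak{aut}(\mathcal{D}_1)=\{\theta(\chi,\varepsilon,a,b,c)\mid \chi\in X(A),\ \varepsilon\in\mathcal{E},\ a,b\in\mathbb{F},\ c\in\mathbb{F}^*\}.$$ Then $$\mathrm{Aut}(\mathcal{D}_1)\cong \mathfrak{r}\rtimes\mathfrak{aut}(\mathcal{D}_1).$$
   Context: Setting: $\mathbb{F}$ is a field of characteristic $0$, $\mathbb{F}^*=\mathbb{F}\setminus\{0\}$, $A\ne 0$ is an abelian group, $T=\mathbb{F}\partial$ is a one-dimensional vector space, and $\varphi:T\times A\to\mathbb{F}$ is a pairing, $\mathbb{F}$-linear in the first variable and additive in the second; write $\partial(x)=\varphi(\partial,x)$. The pairing is nondegenerate, i.e. $\partial(x)=0$ implies $x=0$. The Lie algebra $\mathcal{D}_1$ is the $\mathbb{F}$-vector space with basis $\{t^x\partial,\ t^x \mid x\in A\}$ and brackets, for $x,y\in A$, $$[t^x\partial,t^y\partial]=\partial(y-x)\,t^{x+y}\partial,\qquad [t^x\partial,t^y]=\partial(y)\,t^{x+y},\qquad [t^x,t^y]=0.$$ $\mathrm{Aut}(\mathcal{D}_1)$ is the group of Lie algebra automorphisms of $\mathcal{D}_1$. $\mathfrak{r}$ is the group of inner automorphisms of $\mathcal{D}_1$, i.e. the subgroup generated by $\exp(k\,\mathrm{ad}\,t^x)$, $x\in A$,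 $k\in\mathbb{F}$; it is normal in $\mathrm{Aut}(\mathcal{D}_1)$. $X(A)$ is the group of characters of $A$, i.e. group homomorphisms $A\to\mathbb{F}^*$. Since $\partial$ is injective, $A$ is identified with the additive subgroup $\partial(A)\subset\mathbb{F}$; for $\varepsilon\in\mathbb{F}^*$ and $x\in A$, $\varepsilon x$ denotes the product in $\mathbb{F}$ under this identification (when $\varepsilon\partial(x)\in\partial(A)$, it is the unique $y\in A$ with $\partial(y)=\varepsilon\partial(x)$). Put $\mathcal{E}=\{\varepsilon\in\mathbb{F}^*\mid \mathrm{Span}_{\mathbb{F}}\{t^{\varepsilon x}: x\in A\}=\mathrm{Span}_{\mathbb{F}}\{t^x: x\in A\}\}$, i.e. $\mathcal{E}=\{\varepsilon\in\mathbb{F}^*\mid \varepsilon\,\partial(A)=\partial(A)\}$. For $\chi\in X(A)$, $\varepsilon\in\mathcal{E}$, $a,b\in\mathbb{F}$, $c\in\mathbb{F}^*$, $\theta(\chi,\varepsilon,a,b,c):\mathcal{D}_1\to\mathcal{D}_1$ is the linear map (a Lie algebra automorphism) with, for all $x,y\in A$, $$\theta(t^x\partial)=\varepsilon^{-1}\chi(x)t^{\varepsilon x}\partial+(b\,\partial(x)+a)\chi(x)t^{\varepsilon x},\qquad \theta(t^y)=c\,\chi(y)t^{\varepsilon y}.$$ The set $\mathfrak{aut}(\mathcal{D}_1)$ is a subgroup of $\mathrm{Aut}(\mathcal{D}_1)$. The semidirect product is the internal one: $\mathfrak{r}$ is the normal factor and $\mathfrak{aut}(\mathcal{D}_1)$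 acts on it by conjugation in $\mathrm{Aut}(\mathcal{D}_1)$. *)

theory Defs
  imports
    Complex_Main
    "HOL-Library.Poly_Mapping"
    "HOL-Algebra.Coset"
    "HOL-Algebra.Generated_Groups"
begin

section \<open>The Lie algebra\<close>

text \<open>
  The vector space with basis \<open>t\<^sup>x\<partial>\<close>, \<open>t\<^sup>x\<close> (\<open>x \<in> A\<close>) is the type of finitely supported
  functions on the disjoint union of two copies of \<open>A\<close>: \<open>TD x\<close> stands for \<open>t\<^sup>x\<partial>\<close> and
  \<open>TP x\<close> for \<open>t\<^sup>x\<close>. Throughout, \<open>d :: 'a \<Rightarrow> 'f\<close> is the additive map \<open>x \<mapsto> \<partial>(x)\<close>.
\<close>

datatype 'a d1_basis = TD 'a | TP 'a

type_synonym ('a, 'f) d1 = "'a d1_basis \<Rightarrow>\<^sub>0 'f"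

definition d1_scale :: "'f::field \<Rightarrow> ('a, 'f) d1 \<Rightarrow> ('a, 'f) d1" where
  "d1_scale c v = Poly_Mapping.map ((*) c) v"

definition tD :: "'a \<Rightarrow> ('a, 'f::field) d1" where
  "tD x = Poly_Mapping.single (TD x) 1"

definition tP :: "'a \<Rightarrow> ('a, 'f::field) d1" where
  "tP x = Poly_Mapping.single (TP x) 1"

lemma lookup_d1_scale [simp]:
  "Poly_Mapping.lookup (d1_scale c v) k = c * Poly_Mapping.lookup v k"
  by (simp add: d1_scale_def Poly_Mapping.map.rep_eq when_def)

lemma vector_space_d1: "vector_space (d1_scale :: 'f::field \<Rightarrow> ('a, 'f) d1 \<Rightarrow> ('a, 'f) d1)"
  by unfold_locales (auto intro!: poly_mapping_eqI simp: lookup_add algebra_simps)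

definition lin_ext :: "('a d1_basis \<Rightarrow> ('a, 'f::field) d1) \<Rightarrow> ('a, 'f) d1 \<Rightarrow> ('a, 'f) d1" where
  "lin_ext f v = (\<Sum>u\<in>Poly_Mapping.keys v. d1_scale (Poly_Mapping.lookup v u) (f u))"

fun basis_bracket ::
    "('a::ab_group_add \<Rightarrow> 'f::field) \<Rightarrow> 'a d1_basis \<Rightarrow> 'a d1_basis \<Rightarrow> ('a, 'f) d1" where
  "basis_bracket d (TD x) (TD y) = d1_scale (d (y - x)) (tD (x + y))"
| "basis_bracket d (TD x) (TP y) = d1_scale (d y) (tP (x + y))"
| "basis_bracket d (TP y) (TD x) = - d1_scale (d y) (tP (x + y))"
| "basis_bracket d (TP x) (TP y) = 0"

definition d1_bracket ::
    "('a::ab_group_add \<Rightarrow> 'f::field) \<Rightarrow> ('a, 'f) d1 \<Rightarrow> ('a, 'f) d1 \<Rightarrow> ('a, 'f) d1" where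
  "d1_bracket d v w = lin_ext (\<lambda>u. lin_ext (\<lambda>u'. basis_bracket d u u') w) v"

lemma lin_ext_basis [simp]: "lin_ext f (tD x) = f (TD x)" "lin_ext f (tP x) = f (TP x)"
  by (auto simp: lin_ext_def tD_def tP_def intro!: poly_mapping_eqI)

lemma d1_bracket_basis:
  "d1_bracket d (tD x) (tD y) = d1_scale (d (y - x)) (tD (x + y))"
  "d1_bracket d (tD x) (tP y) = d1_scale (d y) (tP (x + y))"
  "d1_bracket d (tP y) (tD x) = - d1_scale (d y) (tP (x + y))"
  "d1_bracket d (tP x) (tP y) = 0"
  by (simp_all add: d1_bracket_def)

section \<open>Automorphisms\<close>

definition d1_Aut :: "('a::ab_group_add \<Rightarrow> 'f::field) \<Rightarrow> (('a, 'f) d1 \<Rightarrow> ('a, 'f) d1) monoid" where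
  "d1_Aut d = \<lparr>
     carrier = {f. Vector_Spaces.linear d1_scale d1_scale f \<and> bij f \<and>
                   (\<forall>v w. f (d1_bracket d v w) = d1_bracket d (f v) (f w))},
     monoid.mult = (\<circ>),
     one = id\<rparr>"

text \<open>
  The exponential of a locally nilpotent linear map: for such a map the series has only
  finitely many nonzero terms at every vector. (At maps that are not locally nilpotent the
  value is meaningless; here \<open>(ad t\<^sup>x)\<^sup>2 = 0\<close>.)
\<close>

definition d1_exp :: "(('a, 'f::field_char_0) d1 \<Rightarrow> ('a, 'f) d1) \<Rightarrow> ('a, 'f) d1 \<Rightarrow> ('a, 'f) d1" where
  "d1_exp D v = (\<Sum>n | (D ^^ n) v \<noteq> 0. d1_scale (inverse (fact n)) ((D ^^ n) v))"

definition d1_Inn :: "('a::ab_group_add \<Rightarrow> 'f::field_char_0) \<Rightarrow> (('a, 'f) d1 \<Rightarrow> ('a, 'f) d1) set" where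
  "d1_Inn d = generate (d1_Aut d)
     {d1_exp (\<lambda>v. d1_scale k (d1_bracket d (tP x) v)) | k x. True}"

definition characters :: "('a::ab_group_add \<Rightarrow> 'f::field) set" where
  "characters = {\<chi>. (\<forall>x. \<chi> x \<noteq> 0) \<and> (\<forall>x y. \<chi> (x + y) = \<chi> x * \<chi> y)}"

definition dilations :: "('a::ab_group_add \<Rightarrow> 'f::field) \<Rightarrow> 'f set" where
  "dilations d = {\<epsilon>. \<epsilon> \<noteq> 0 \<and> (*) \<epsilon> ` range d = range d}"

text \<open>The element \<open>\<epsilon>x\<close> of \<open>A\<close>, where \<open>A\<close> is identified with \<open>range d\<close>.\<close>

definition dil :: "('a::ab_group_add \<Rightarrow> 'f::field) \<Rightarrow> 'f \<Rightarrow> 'a \<Rightarrow> 'a" where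
  "dil d \<epsilon> x = (THE y. d y = \<epsilon> * d x)"

fun theta_basis :: "('a::ab_group_add \<Rightarrow> 'f::field) \<Rightarrow> ('a \<Rightarrow> 'f) \<Rightarrow> 'f \<Rightarrow> 'f \<Rightarrow> 'f \<Rightarrow> 'f \<Rightarrow>
    'a d1_basis \<Rightarrow> ('a, 'f) d1" where
  "theta_basis d \<chi> \<epsilon> a b c (TD x) =
     d1_scale (inverse \<epsilon> * \<chi> x) (tD (dil d \<epsilon> x)) +
     d1_scale ((b * d x + a) * \<chi> x) (tP (dil d \<epsilon> x))"
| "theta_basis d \<chi> \<epsilon> a b c (TP y) = d1_scale (c * \<chi> y) (tP (dil d \<epsilon> y))"

definition theta :: "('a::ab_group_add \<Rightarrow> 'f::field) \<Rightarrow> ('a \<Rightarrow> 'f) \<Rightarrow> 'f \<Rightarrow> 'f \<Rightarrow> 'f \<Rightarrow> 'f \<Rightarrow>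
    ('a, 'f) d1 \<Rightarrow> ('a, 'f) d1" where
  "theta d \<chi> \<epsilon> a b c = lin_ext (theta_basis d \<chi> \<epsilon> a b c)"

definition aut_D1 :: "('a::ab_group_add \<Rightarrow> 'f::field) \<Rightarrow> (('a, 'f) d1 \<Rightarrow> ('a, 'f) d1) set" where
  "aut_D1 d = {theta d \<chi> \<epsilon> a b c | \<chi> \<epsilon> a b c. \<chi> \<in> characters \<and> \<epsilon> \<in> dilations d \<and> c \<noteq> 0}"

section \<open>Semidirect products of subgroups\<close>

text \<open>\<open>G\<close> is the internal semidirect product of the normal subgroup \<open>N\<close> and the subgroup \<open>H\<close>.\<close>

definition internal_semidirect :: "('g, 'm) monoid_scheme \<Rightarrow> 'g set \<Rightarrow> 'g set \<Rightarrow> bool" where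
  "internal_semidirect G N H \<longleftrightarrow>
     N \<lhd> G \<and> subgroup H G \<and> N \<inter> H = {\<one>\<^bsub>G\<^esub>} \<and> N <#>\<^bsub>G\<^esub> H = carrier G"

text \<open>The group \<open>N \<rtimes> H\<close>, with \<open>H\<close> acting on \<open>N\<close> by conjugation in \<open>G\<close>.\<close>

definition conj_semidirect :: "('g, 'm) monoid_scheme \<Rightarrow> 'g set \<Rightarrow> 'g set \<Rightarrow> ('g \<times> 'g) monoid" where
  "conj_semidirect G N H = \<lparr>
     carrier = N \<times> H,
     monoid.mult = (\<lambda>(n, h) (n', h').
       (n \<otimes>\<^bsub>G\<^esub> (h \<otimes>\<^bsub>G\<^esub> n' \<otimes>\<^bsub>G\<^esub> inv\<^bsub>G\<^esub> h), h \<otimes>\<^bsub>G\<^esub> h')),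
     one = (\<one>\<^bsub>G\<^esub>, \<one>\<^bsub>G\<^esub>)\<rparr>"

end

theory Submission
  imports Defs
begin

text \<open>
  The span \<open>d1_P\<close> of the \<open>t\<^sup>x\<close> is the largest abelian ideal, so every automorphism \<open>f\<close> preserves it, and
  the inner automorphisms are exactly the maps \<open>v \<mapsto> v + [q, v]\<close> with \<open>q\<close> in \<open>d1_P\<close>. Since \<open>f(\<partial>)\<close> acts on
  \<open>d1_P\<close> with the same eigenvalues as \<open>\<partial>\<close>, comparing leading and lowest terms for a total order on \<open>A\<close>
  shows \<open>f(\<partial>) = s\<partial> + p\<close> with \<open>s\<close> a nonzero scalar and \<open>p\<close> in \<open>d1_P\<close>. An inner automorphism reduces \<open>p\<close>
  to a multiple of the central element \<open>t\<^sup>0\<close>; then \<open>f\<close> maps eigenvectors of \<open>ad \<partial>\<close> to eigenvectors,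
  and the bracket relations between their coefficients force \<open>f\<close> to be some \<open>\<theta>(\<chi>, \<epsilon>, a, b, c)\<close>.
\<close>

subsection \<open>Linear maps and the bracket\<close>

interpretation d1: vector_space d1_scale
  by (rule vector_space_d1)

abbreviation d1_linear :: "(('a, 'f::field) d1 \<Rightarrow> ('b, 'f) d1) \<Rightarrow> bool" where
  "d1_linear \<equiv> Vector_Spaces.linear d1_scale d1_scale"

lemma d1_linearI:
  assumes "\<And>v w. f (v + w) = f v + f w" "\<And>c v. f (d1_scale c v) = d1_scale c (f v)"
  shows "d1_linear f"
  using assms by (simp add: Vector_Spaces.linear_iff vector_space_d1)

lemma d1_linearD:
  assumes "d1_linear f"
  shows "f (v + w) = f v + f w" "f (d1_scale c v) = d1_scale c (f v)" "f 0 = 0" "f (- v) = - f v"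
    "f (v - w) = f v - f w" "f (sum g S) = (\<Sum>i\<in>S. f (g i))"
proof -
  interpret module_hom d1_scale d1_scale f
    using assms by (rule Vector_Spaces.linear.axioms(3))
  show "f (v + w) = f v + f w" "f (d1_scale c v) = d1_scale c (f v)" "f 0 = 0" "f (- v) = - f v"
    "f (v - w) = f v - f w" "f (sum g S) = (\<Sum>i\<in>S. f (g i))"
    by (simp_all add: add scale neg diff sum)
qed

text \<open>Extra indices contribute zero coefficients. The supports of \<open>v\<close>,
  \<open>w\<close> and \<open>v + w\<close> differ, and additivity of \<open>lin_ext\<close>
  compares their sums over one common finite set.\<close>

lemma lin_ext_superset:
  assumes "finite S" "Poly_Mapping.keys v \<subseteq> S"
  shows "lin_ext f v = (\<Sum>u\<in>S. d1_scale (Poly_Mapping.lookup v u) (f u))"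
  unfolding lin_ext_def
  by (rule sum.mono_neutral_left) (use assms in \<open>auto simp: in_keys_iff\<close>)

lemma d1_linear_lin_ext: "d1_linear (lin_ext f)"
  for f :: "'a d1_basis \<Rightarrow> ('a, 'f::field) d1"
proof (rule d1_linearI)
  fix v w :: "('a, 'f) d1" and c
  let ?S = "Poly_Mapping.keys v \<union> Poly_Mapping.keys w"
  have "Poly_Mapping.keys (v + w) \<subseteq> ?S"
    by (rule Poly_Mapping.keys_add)
  then have "lin_ext f (v + w) = (\<Sum>u\<in>?S. d1_scale (Poly_Mapping.lookup (v + w) u) (f u))"
    by (intro lin_ext_superset) auto
  also have "\<dots> = lin_ext f v + lin_ext f w"
    by (subst (1 2) lin_ext_superset[of ?S])
      (auto simp: lookup_add d1.scale_left_distrib sum.distrib)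
  finally show "lin_ext f (v + w) = lin_ext f v + lin_ext f w" .
  have "Poly_Mapping.keys (d1_scale c v) \<subseteq> Poly_Mapping.keys v"
    by (auto simp: in_keys_iff)
  then have "lin_ext f (d1_scale c v) =
      (\<Sum>u\<in>Poly_Mapping.keys v. d1_scale (Poly_Mapping.lookup (d1_scale c v) u) (f u))"
    by (intro lin_ext_superset) auto
  then show "lin_ext f (d1_scale c v) = d1_scale c (lin_ext f v)"
    by (simp add: lin_ext_def d1.scale_sum_right)
qed

lemma d1_induct [case_names tD tP add scale]:
  assumes tD: "\<And>x. P (tD x)" and tP: "\<And>x. P (tP x)"
    and add: "\<And>v w. P v \<Longrightarrow> P w \<Longrightarrow> P (v + w)" and scale: "\<And>c v. P v \<Longrightarrow> P (d1_scale c v)"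
  shows "P v"
proof -
  have basis: "P (Poly_Mapping.single u 1)" for u
    using tD tP by (cases u) (auto simp: tD_def tP_def)
  have "P 0"
    using scale[of "tD undefined" 0] tD by simp
  then show ?thesis
  proof (induction v rule: update_induct)
    case (update f u b)
    have "Poly_Mapping.update u b f = f + d1_scale b (Poly_Mapping.single u 1)"
      using update.hyps(1)
      by (intro poly_mapping_eqI) (auto simp: lookup_add lookup_update lookup_single when_def in_keys_iff)
    then show ?case
      using update basis by (simp add: add scale)
  qed simp
qed

lemma d1_linear_eqI:
  assumes "d1_linear f" "d1_linear g" "\<And>x. f (tD x) = g (tD x)" "\<And>x. f (tP x) = g (tP x)"
  shows "f v = g v"
  by (induction v rule: d1_induct)
    (simp_all add: assms d1_linearD(1,2)[OF assms(1)] d1_linearD(1,2)[OF assms(2)])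

lemma lookup_tD [simp]:
  "Poly_Mapping.lookup (tD x) (TD z) = (1 when x = z)" "Poly_Mapping.lookup (tD x) (TP z) = 0"
  by (simp_all add: tD_def lookup_single when_def)

lemma lookup_tP [simp]:
  "Poly_Mapping.lookup (tP x) (TP z) = (1 when x = z)" "Poly_Mapping.lookup (tP x) (TD z) = 0"
  by (simp_all add: tP_def lookup_single when_def)

lemma d1_eqI:
  assumes "\<And>z. Poly_Mapping.lookup v (TD z) = Poly_Mapping.lookup w (TD z)"
    "\<And>z. Poly_Mapping.lookup v (TP z) = Poly_Mapping.lookup w (TP z)"
  shows "v = w"
proof (rule poly_mapping_eqI)
  fix u
  show "Poly_Mapping.lookup v u = Poly_Mapping.lookup w u"
    using assms by (cases u) auto
qed

lemma d1_linear_bracket_left: "d1_linear (\<lambda>v. d1_bracket d v w)"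
  using d1_linear_lin_ext by (simp add: d1_bracket_def)

lemma d1_linear_bracket_right: "d1_linear (d1_bracket d v)"
  by (rule d1_linearI)
    (simp_all add: d1_bracket_def d1_linearD(1,2)[OF d1_linear_lin_ext],
     simp_all add: lin_ext_def d1.scale_right_distrib sum.distrib d1.scale_sum_right ac_simps)

lemmas bracket_left = d1_linearD[OF d1_linear_bracket_left]
lemmas bracket_right = d1_linearD[OF d1_linear_bracket_right]

lemma bracket_hom_basisI:
  assumes lin: "d1_linear f"
    and DD: "\<And>x y. f (d1_bracket d (tD x) (tD y)) = d1_bracket d (f (tD x)) (f (tD y))"
    and DP: "\<And>x y. f (d1_bracket d (tD x) (tP y)) = d1_bracket d (f (tD x)) (f (tP y))"
    and PD: "\<And>x y. f (d1_bracket d (tP y) (tD x)) = d1_bracket d (f (tP y)) (f (tD x))"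
    and PP: "\<And>x y. f (d1_bracket d (tP x) (tP y)) = d1_bracket d (f (tP x)) (f (tP y))"
  shows "f (d1_bracket d v w) = d1_bracket d (f v) (f w)"
proof -
  note f = d1_linearD(1,2)[OF lin]
  have D: "f (d1_bracket d (tD x) w) = d1_bracket d (f (tD x)) (f w)" for x
    by (induction w rule: d1_induct) (simp_all add: DD DP f bracket_right)
  have P: "f (d1_bracket d (tP x) w) = d1_bracket d (f (tP x)) (f w)" for x
    by (induction w rule: d1_induct) (simp_all add: PD PP f bracket_right)
  show ?thesis
    by (induction v rule: d1_induct) (simp_all add: D P f bracket_left)
qed

lemma bracket_antisym_basis:
  "d1_bracket d v w = - d1_bracket d w v" if "\<And>x. d (- x) = - d x" for d :: "'a::ab_group_add \<Rightarrow> 'f::field"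
proof -
  have neg: "d (x - y) = - d (y - x)" for x y
    using that[of "y - x"] by simp
  have D: "d1_bracket d (tD x) w = - d1_bracket d w (tD x)" for x
  proof (induction w rule: d1_induct)
    case (tD y)
    then show ?case
      using neg[of y x] by (simp add: d1_bracket_basis add.commute)
  qed (simp_all add: d1_bracket_basis bracket_left bracket_right)
  have P: "d1_bracket d (tP x) w = - d1_bracket d w (tP x)" for x
    by (induction w rule: d1_induct) (simp_all add: d1_bracket_basis bracket_left bracket_right)
  show ?thesis
    by (induction v rule: d1_induct) (simp_all add: D P bracket_left bracket_right)
qed

text \<open>The coefficientwise form makes membership checkable by \<open>d1_eqI\<close> and
  \<open>lookup\<close> rules; generation by the \<open>tP x\<close> is recovered in
  \<open>d1_P_induct\<close>.\<close>

definition d1_P :: "('a, 'f::field) d1 set" where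
  "d1_P = {v. \<forall>x. Poly_Mapping.lookup v (TD x) = 0}"

lemma d1_P_closed [simp]:
  "0 \<in> d1_P" "tP x \<in> d1_P" "v \<in> d1_P \<Longrightarrow> d1_scale c v \<in> d1_P" "v \<in> d1_P \<Longrightarrow> - v \<in> d1_P"
  "v \<in> d1_P \<Longrightarrow> w \<in> d1_P \<Longrightarrow> v + w \<in> d1_P" "v \<in> d1_P \<Longrightarrow> w \<in> d1_P \<Longrightarrow> v - w \<in> d1_P"
  by (auto simp: d1_P_def lookup_add lookup_minus)

lemma d1_decompose: "lin_ext (\<lambda>u. Poly_Mapping.single u 1) v = v"
  by (induction v rule: d1_induct)
    (simp_all add: d1_linearD(1,2)[OF d1_linear_lin_ext], simp_all add: tD_def tP_def)

lemma d1_linear_expand: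
  assumes "d1_linear f"
  shows "f v = (\<Sum>u\<in>Poly_Mapping.keys v. d1_scale (Poly_Mapping.lookup v u) (f (Poly_Mapping.single u 1)))"
  by (subst d1_decompose[of v, symmetric])
    (simp add: lin_ext_def d1_linearD[OF assms])

text \<open>The projection \<open>pr\<close> kills every \<open>tD x\<close> and fixes every
  \<open>tP x\<close>. Induction over the whole algebra gives \<open>Q\<close> on its image, and an
  element of \<open>d1_P\<close> is its own projection.\<close>

lemma d1_P_induct [consumes 1, case_names tP add scale]:
  fixes v :: "('a, 'f::field) d1"
  assumes v: "v \<in> d1_P" and tP: "\<And>x. Q (tP x)"
    and add: "\<And>v w. v \<in> d1_P \<Longrightarrow> w \<in> d1_P \<Longrightarrow> Q v \<Longrightarrow> Q w \<Longrightarrow> Q (v + w)"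
    and scale: "\<And>c v. v \<in> d1_P \<Longrightarrow> Q v \<Longrightarrow> Q (d1_scale c v)"
  shows "Q v"
proof -
  define pr :: "('a, 'f) d1 \<Rightarrow> ('a, 'f) d1" where
    "pr = lin_ext (\<lambda>u. case u of TD x \<Rightarrow> 0 | TP x \<Rightarrow> tP x)"
  have "d1_linear pr"
    unfolding pr_def by (rule d1_linear_lin_ext)
  note pr = d1_linearD[OF this]
  have Q0: "Q 0"
    using scale[of "tP undefined" 0] tP by simp
  have prQ: "pr w \<in> d1_P \<and> Q (pr w)" for w
  proof (induction w rule: d1_induct)
    case (tD x)
    show ?case
      using Q0 by (simp add: pr_def)
  next
    case (tP x)
    show ?case
      using assms(2) by (simp add: pr_def)
  qed (simp_all add: pr add scale)
  have lookup_pr: "Poly_Mapping.lookup (pr w) (TD z) = 0"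
    "Poly_Mapping.lookup (pr w) (TP z) = Poly_Mapping.lookup w (TP z)" for w z
    by (induction w rule: d1_induct) (simp_all add: pr lookup_add, simp_all add: pr_def)
  have "pr v = v"
    using v by (intro d1_eqI) (simp_all add: lookup_pr d1_P_def)
  then show ?thesis
    using prQ[of v] by simp
qed

subsection \<open>Inner automorphisms\<close>

text \<open>The exponential of \<open>ad q\<close> for \<open>q\<close> in the abelian ideal \<open>d1_P\<close>, where \<open>(ad q)\<^sup>2 = 0\<close>.\<close>

definition d1_shear :: "('a::ab_group_add \<Rightarrow> 'f::field) \<Rightarrow> ('a, 'f) d1 \<Rightarrow> ('a, 'f) d1 \<Rightarrow> ('a, 'f) d1" where
  "d1_shear d q v = v + d1_bracket d q v"

lemma d1_linear_shear: "d1_linear (d1_shear d q)"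
  by (rule d1_linearI) (simp_all add: d1_shear_def bracket_right d1.scale_right_distrib)

lemma d1_shear_zero [simp]: "d1_shear d 0 = id"
  by (simp add: d1_shear_def fun_eq_iff bracket_left)

locale d1_pairing =
  fixes d :: "'a::ab_group_add \<Rightarrow> 'f::field_char_0"
  assumes nontrivial: "\<exists>x::'a. x \<noteq> 0"
    and additive: "\<And>x y. d (x + y) = d x + d y"
    and nondegenerate: "\<And>x. x \<noteq> 0 \<Longrightarrow> d x \<noteq> 0"
begin

lemma d_zero [simp]: "d 0 = 0"
  using additive[of 0 0] by simp

lemma d_minus [simp]: "d (- x) = - d x"
  using additive[of x "- x"] by (simp add: eq_neg_iff_add_eq_0 add.commute)

lemma d_diff [simp]: "d (x - y) = d x - d y"
  using additive[of x "- y"] by simp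

lemmas d_add [simp] = additive

lemma d_eq_iff [simp]: "d x = d y \<longleftrightarrow> x = y"
  using nondegenerate[of "x - y"] by auto

lemma d_eq_0_iff [simp]: "d x = 0 \<longleftrightarrow> x = 0"
  using d_eq_iff[of x 0] by simp

lemma bracket_antisym: "d1_bracket d v w = - d1_bracket d w v"
  by (rule bracket_antisym_basis) simp

lemma bracket_P_left: "q \<in> d1_P \<Longrightarrow> d1_bracket d q v \<in> d1_P"
proof (induction q rule: d1_P_induct)
  case (tP x)
  show ?case
    by (induction v rule: d1_induct) (simp_all add: bracket_right d1_bracket_basis)
qed (simp_all add: bracket_left)

lemma bracket_P_right: "q \<in> d1_P \<Longrightarrow> d1_bracket d v q \<in> d1_P"
  using bracket_P_left[of q v] by (simp add: bracket_antisym[of v q])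

lemma bracket_P_P:
  assumes "q \<in> d1_P" "q' \<in> d1_P"
  shows "d1_bracket d q q' = 0"
  using assms(1)
proof (induction q rule: d1_P_induct)
  case (tP x)
  show ?case
    using assms(2) by (induction q' rule: d1_P_induct) (simp_all add: bracket_right d1_bracket_basis)
qed (simp_all add: bracket_left)

text \<open>This is the part of the Jacobi identity that shears need. If a second entry lies in
  \<open>d1_P\<close>, every term vanishes because \<open>d1_P\<close> is an abelian ideal, so only
  two entries \<open>tD y\<close>, \<open>tD z\<close> require computation.\<close>

lemma bracket_derivation_P:
  assumes "q \<in> d1_P"
  shows "d1_bracket d q (d1_bracket d v w) =
    d1_bracket d (d1_bracket d q v) w + d1_bracket d v (d1_bracket d q w)"
  using assms
proof (induction q rule: d1_P_induct)
  case (tP x)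
  have PP: "d1_bracket d (tP x) (d1_bracket d v (tP y)) =
      d1_bracket d (d1_bracket d (tP x) v) (tP y) + d1_bracket d v (d1_bracket d (tP x) (tP y))" for v y
    by (simp add: bracket_P_P bracket_P_left bracket_P_right bracket_right)
  have DD: "d1_bracket d (tP x) (d1_bracket d (tD y) (tD z)) =
      d1_bracket d (d1_bracket d (tP x) (tD y)) (tD z) + d1_bracket d (tD y) (d1_bracket d (tP x) (tD z))" for y z
    by (rule d1_eqI)
      (auto simp: d1_bracket_basis bracket_right bracket_left lookup_add when_def algebra_simps)
  have PD: "d1_bracket d (tP x) (d1_bracket d (tP y) w) =
      d1_bracket d (d1_bracket d (tP x) (tP y)) w + d1_bracket d (tP y) (d1_bracket d (tP x) w)" for w y
    by (simp add: bracket_P_P bracket_P_left bracket_P_right bracket_left)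
  have D: "d1_bracket d (tP x) (d1_bracket d (tD y) w) =
      d1_bracket d (d1_bracket d (tP x) (tD y)) w + d1_bracket d (tD y) (d1_bracket d (tP x) w)" for y
    by (induction w rule: d1_induct) (simp_all add: DD PP bracket_right d1.scale_right_distrib)
  show ?case
    by (induction v rule: d1_induct) (simp_all add: D PD bracket_right bracket_left d1.scale_right_distrib)
qed (simp_all add: bracket_left bracket_right d1.scale_right_distrib)

text \<open>Expanding the right side leaves the derivation identity plus the quadratic term
  \<open>[[q, v], [q, w]]\<close>, which is a bracket of two elements of
  \<open>d1_P\<close>.\<close>

lemma shear_hom:
  assumes "q \<in> d1_P"
  shows "d1_shear d q (d1_bracket d v w) = d1_bracket d (d1_shear d q v) (d1_shear d q w)"
  using assms by (simp add: d1_shear_def bracket_derivation_P bracket_left bracket_right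
      bracket_P_P bracket_P_left)

text \<open>The cross term \<open>[q, [q', v]]\<close> vanishes, so shears form a homomorphic image
  of the additive group \<open>d1_P\<close>.\<close>

lemma shear_comp:
  assumes "q \<in> d1_P" "q' \<in> d1_P"
  shows "d1_shear d q \<circ> d1_shear d q' = d1_shear d (q + q')"
  using assms by (simp add: d1_shear_def fun_eq_iff bracket_left bracket_right bracket_P_P bracket_P_left)

section \<open>The automorphism group and its inner automorphisms\<close>

lemma in_carrier_Aut:
  "f \<in> carrier (d1_Aut d) \<longleftrightarrow>
    d1_linear f \<and> bij f \<and> (\<forall>v w. f (d1_bracket d v w) = d1_bracket d (f v) (f w))"
  by (simp add: d1_Aut_def)

lemma mult_Aut [simp]: "f \<otimes>\<^bsub>d1_Aut d\<^esub> g = f \<circ> g"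
  and one_Aut [simp]: "\<one>\<^bsub>d1_Aut d\<^esub> = id"
  by (simp_all add: d1_Aut_def)

lemma bij_of_comp_id:
  assumes "f \<circ> g = id" "g \<circ> f = id"
  shows "bij f"
  using assms by (rule o_bij[rotated])

lemma shear_in_Aut: "q \<in> d1_P \<Longrightarrow> d1_shear d q \<in> carrier (d1_Aut d)"
  using shear_comp[of q "- q"] shear_comp[of "- q" q] bij_of_comp_id[of "d1_shear d q" "d1_shear d (- q)"]
  by (auto simp: in_carrier_Aut d1_linear_shear shear_hom)

lemma group_Aut: "group (d1_Aut d)"
proof (rule groupI)
  fix f assume f: "f \<in> carrier (d1_Aut d)"
  have bij: "bij f" and lin: "d1_linear f" and hom: "\<And>v w. f (d1_bracket d v w) = d1_bracket d (f v) (f w)"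
    using f by (auto simp: in_carrier_Aut)
  let ?g = "inv_into UNIV f"
  have inv_f: "f (?g v) = v" "?g (f v) = v" for v
    using bij by (simp_all add: bij_is_surj surj_f_inv_f bij_is_inj)
  have eq: "?g v = w" if "v = f w" for v w
    using that inv_f by simp
  have "?g \<in> carrier (d1_Aut d)"
    unfolding in_carrier_Aut
    by (intro conjI allI d1_linearI bij_imp_bij_inv bij eq) (simp_all add: d1_linearD[OF lin] hom inv_f)
  moreover have "?g \<circ> f = id"
    using inv_f by auto
  ultimately show "\<exists>g\<in>carrier (d1_Aut d). g \<otimes>\<^bsub>d1_Aut d\<^esub> f = \<one>\<^bsub>d1_Aut d\<^esub>"
    by auto
next
  fix f g assume "f \<in> carrier (d1_Aut d)" "g \<in> carrier (d1_Aut d)"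
  then show "f \<otimes>\<^bsub>d1_Aut d\<^esub> g \<in> carrier (d1_Aut d)"
    by (auto simp: in_carrier_Aut bij_comp intro: d1_linearI simp: d1_linearD)
next
  show "\<one>\<^bsub>d1_Aut d\<^esub> \<in> carrier (d1_Aut d)"
    by (auto simp: in_carrier_Aut intro: d1_linearI)
qed (simp_all add: comp_assoc)

lemma inv_Aut:
  assumes "f \<in> carrier (d1_Aut d)" "g \<in> carrier (d1_Aut d)" "g \<circ> f = id"
  shows "inv\<^bsub>d1_Aut d\<^esub> f = g"
  using group.inv_equality[OF group_Aut, of g f] assms by simp

lemma exp_ad_tP:
  "d1_exp (\<lambda>v. d1_scale k (d1_bracket d (tP x) v)) = d1_shear d (d1_scale k (tP x))"
proof
  fix v
  define D where "D = d1_bracket d (d1_scale k (tP x))"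
  have D: "(\<lambda>v. d1_scale k (d1_bracket d (tP x) v)) = D"
    by (simp add: D_def fun_eq_iff bracket_left)
  have "D (D w) = 0" for w
    by (simp add: D_def bracket_P_P bracket_P_left)
  then have high: "(D ^^ Suc (Suc n)) v = 0" for n
    by simp
  \<comment> \<open>Only an inclusion holds in general, since \<open>v\<close> or \<open>D v\<close>
    may be zero; the missing terms of the exponential sum are zero anyway.\<close>
  have "{n. (D ^^ n) v \<noteq> 0} \<subseteq> {0, 1}"
  proof
    fix n assume "n \<in> {n. (D ^^ n) v \<noteq> 0}"
    then show "n \<in> {0, 1}"
      using high[of "n - 2"] by (cases n; cases "n - 1") auto
  qed
  then have "d1_exp D v = (\<Sum>n\<in>{0, 1}. d1_scale (inverse (fact n)) ((D ^^ n) v))"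
    unfolding d1_exp_def by (intro sum.mono_neutral_left) auto
  then show "d1_exp (\<lambda>v. d1_scale k (d1_bracket d (tP x) v)) v = d1_shear d (d1_scale k (tP x)) v"
    by (simp add: D d1_shear_def D_def)
qed

lemma shear_subgroup: "subgroup (d1_shear d ` d1_P) (d1_Aut d)"
proof (rule group.subgroupI[OF group_Aut])
  fix f assume "f \<in> d1_shear d ` d1_P"
  then obtain q where q: "q \<in> d1_P" "f = d1_shear d q"
    by auto
  then have "inv\<^bsub>d1_Aut d\<^esub> f = d1_shear d (- q)"
    by (intro inv_Aut) (simp_all add: shear_in_Aut shear_comp)
  then show "inv\<^bsub>d1_Aut d\<^esub> f \<in> d1_shear d ` d1_P"
    using q by simp
next
  show "d1_shear d ` d1_P \<noteq> {}"
    using d1_P_closed(1) by blast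
qed (auto simp: shear_in_Aut shear_comp)

text \<open>Composition of shears adds their parameters, and the multiples of the
  \<open>tP x\<close> generate \<open>d1_P\<close> additively.\<close>

lemma Inn_eq: "d1_Inn d = d1_shear d ` d1_P"
proof
  show "d1_Inn d \<subseteq> d1_shear d ` d1_P"
    unfolding d1_Inn_def
    by (rule group.generate_subgroup_incl[OF group_Aut _ shear_subgroup]) (auto simp: exp_ad_tP)
  have gen: "d1_shear d (d1_scale k (tP x)) \<in> d1_Inn d" for k x
    unfolding d1_Inn_def by (rule generate.incl) (auto simp: exp_ad_tP[symmetric])
  \<comment> \<open>The free scalar \<open>k\<close> absorbs the scaling case of the induction: a
    generated subgroup is not visibly closed under rescaling of \<open>q\<close>.\<close>
  have "d1_shear d (d1_scale k q) \<in> d1_Inn d" if "q \<in> d1_P" for k q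
    using that
  proof (induction q arbitrary: k rule: d1_P_induct)
    case (add v w)
    then have "d1_shear d (d1_scale k (v + w)) =
        d1_shear d (d1_scale k v) \<otimes>\<^bsub>d1_Aut d\<^esub> d1_shear d (d1_scale k w)"
      by (simp add: shear_comp d1.scale_right_distrib)
    then show ?case
      using add unfolding d1_Inn_def by (simp only: generate.eng)
  qed (simp_all add: gen)
  from this[of _ 1] show "d1_shear d ` d1_P \<subseteq> d1_Inn d"
    by auto
qed

end

subsection \<open>Total orders\<close>

text \<open>The cone of nonnegative elements of a translation-invariant total order, with
  \<open>x \<le> y\<close> read as \<open>y - x \<in> C\<close>. As a set it can be reversed by
  negation and pulled back along \<open>d\<close>.\<close>

definition total_cone :: "'a::ab_group_add set \<Rightarrow> bool" where
  "total_cone C \<longleftrightarrow> (\<forall>x\<in>C. \<forall>y\<in>C. x + y \<in> C) \<and> (\<forall>x\<in>C. - x \<in> C \<longrightarrow> x = 0) \<and> (\<forall>x. x \<in> C \<or> - x \<in> C)"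

lemma total_coneD:
  assumes "total_cone C"
  shows "x \<in> C \<Longrightarrow> y \<in> C \<Longrightarrow> x + y \<in> C" "x \<in> C \<Longrightarrow> - x \<in> C \<Longrightarrow> x = 0" "x \<in> C \<or> - x \<in> C"
  using assms by (auto simp: total_cone_def)

lemma total_cone_uminus: "total_cone C \<Longrightarrow> total_cone {x. - x \<in> C}"
  using total_coneD(1)[of C "- _" "- _"] total_coneD(2)[of C "- _"] total_coneD(3)[of C "- _"]
  by (auto simp: total_cone_def)

text \<open>A maximal pointed convex cone over \<open>\<rat>\<close> is total: it cannot be enlarged by a ray.\<close>

lemma ex_total_cone: "\<exists>K :: 'f::field_char_0 set. total_cone K"
proof -
  \<comment> \<open>Closure under positive rational multiples is added to the conditions of
    \<open>total_cone\<close> so that a relation in the enlarged cone can later be divided by its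
    coefficient.\<close>
  define \<A> where "\<A> = {K :: 'f set. 0 \<in> K \<and> (\<forall>x\<in>K. \<forall>y\<in>K. x + y \<in> K) \<and>
    (\<forall>x\<in>K. - x \<in> K \<longrightarrow> x = 0) \<and> (\<forall>q>0. \<forall>x\<in>K. of_rat q * x \<in> K)}"
  have "{0} \<in> \<A>"
    by (simp add: \<A>_def)
  then have "\<A> \<noteq> {}"
    by blast
  moreover have "\<Union>\<C> \<in> \<A>" if "\<C> \<noteq> {}" "subset.chain \<A> \<C>" for \<C>
  proof -
    have sub: "\<C> \<subseteq> \<A>"
      using that(2) by (simp add: subset_chain_def)
    \<comment> \<open>In a chain, two elements of the union already lie in one member, which reduces
      every closure condition to a single cone.\<close>
    have common: "\<exists>K\<in>\<C>. x \<in> K \<and> y \<in> K" if xy: "x \<in> \<Union>\<C>" "y \<in> \<Union>\<C>" for x y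
    proof -
      obtain K L where "K \<in> \<C>" "L \<in> \<C>" "x \<in> K" "y \<in> L"
        using xy by blast
      moreover from this have "K \<subseteq> L \<or> L \<subseteq> K"
        using \<open>subset.chain \<A> \<C>\<close> by (simp add: subset_chain_def)
      ultimately show ?thesis
        by blast
    qed
    show ?thesis
      unfolding \<A>_def mem_Collect_eq
    proof (intro conjI ballI allI impI)
      show "0 \<in> \<Union>\<C>"
        using that(1) sub by (auto simp: \<A>_def)
    next
      fix x y assume "x \<in> \<Union>\<C>" "y \<in> \<Union>\<C>"
      then obtain K where "K \<in> \<C>" "x \<in> K" "y \<in> K"
        using common by blast
      moreover from this have "x + y \<in> K"
        using sub by (auto simp: \<A>_def)
      ultimately show "x + y \<in> \<Union>\<C>"
        by blast
    next
      fix x assume "x \<in> \<Union>\<C>" "- x \<in> \<Union>\<C>"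
      then obtain K where "K \<in> \<C>" "x \<in> K" "- x \<in> K"
        using common by blast
      then show "x = 0"
        using sub by (auto simp: \<A>_def)
    next
      fix q x assume "(0::rat) < q" "x \<in> \<Union>\<C>"
      then obtain K where "K \<in> \<C>" "x \<in> K"
        by blast
      moreover from this have "of_rat q * x \<in> K"
        using sub \<open>0 < q\<close> by (auto simp: \<A>_def)
      ultimately show "of_rat q * x \<in> \<Union>\<C>"
        by blast
    qed
  qed
  ultimately obtain K where K: "K \<in> \<A>" and max: "\<And>X. X \<in> \<A> \<Longrightarrow> K \<subseteq> X \<Longrightarrow> X = K"
    using subset_Zorn_nonempty[of \<A>] by blast
  have K0: "0 \<in> K" and Kadd: "\<And>x y. x \<in> K \<Longrightarrow> y \<in> K \<Longrightarrow> x + y \<in> K"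
    and Kneg: "\<And>x. x \<in> K \<Longrightarrow> - x \<in> K \<Longrightarrow> x = 0" and Kq: "\<And>q x. 0 < q \<Longrightarrow> x \<in> K \<Longrightarrow> of_rat q * x \<in> K"
    using K by (simp_all add: \<A>_def)
  have "x \<in> K" if x: "- x \<notin> K" for x
  proof -
    \<comment> \<open>The cone obtained from \<open>K\<close> by adjoining the ray through
      \<open>x\<close>. If it is pointed, maximality puts \<open>x\<close> into
      \<open>K\<close>.\<close>
    define X where "X = {c + of_rat q * x | c q. c \<in> K \<and> 0 \<le> q}"
    have XI: "c + of_rat q * x \<in> X" if "c \<in> K" "0 \<le> q" for c q
      using that by (auto simp: X_def)
    have "X \<in> \<A>"
      unfolding \<A>_def mem_Collect_eq
    proof (intro conjI ballI allI impI)
      show "0 \<in> X"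
        using XI[OF K0, of 0] by simp
    next
      fix y z assume "y \<in> X" "z \<in> X"
      then obtain c q c' q' where "y = c + of_rat q * x" "z = c' + of_rat q' * x" "c \<in> K" "c' \<in> K" "0 \<le> q" "0 \<le> q'"
        by (auto simp: X_def)
      then show "y + z \<in> X"
        using XI[of "c + c'" "q + q'"] by (simp add: Kadd of_rat_add algebra_simps)
    next
      fix q y assume "(0::rat) < q" "y \<in> X"
      then obtain c r where "y = c + of_rat r * x" "c \<in> K" "0 \<le> r"
        by (auto simp: X_def)
      moreover from this have "of_rat q * c + of_rat (q * r) * x \<in> X"
        using \<open>0 < q\<close> by (intro XI Kq) simp_all
      ultimately show "of_rat q * y \<in> X"
        by (simp add: of_rat_mult algebra_simps)
    next
      fix y assume "y \<in> X" "- y \<in> X"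
      then obtain c q c' q' where y: "y = c + of_rat q * x" "- y = c' + of_rat q' * x"
        and c: "c \<in> K" "c' \<in> K" "0 \<le> q" "0 \<le> q'"
        by (auto simp: X_def)
      from y have "c + of_rat q * x + (c' + of_rat q' * x) = 0"
        by (metis add.right_inverse)
      then have sum0: "c + c' + of_rat (q + q') * x = 0"
        by (simp add: of_rat_add algebra_simps)
      show "y = 0"
      proof (cases "q + q' = 0")
        case True
        then have "q = 0" "q' = 0"
          using c by auto
        with y c Kneg show ?thesis
          by auto
      next
        case False
        then have pos: "0 < q + q'"
          using c by simp
        \<comment> \<open>Dividing by the positive rational \<open>q + q'\<close> exhibits
          \<open>- x\<close> as an element of \<open>K\<close>, contrary to the choice of
          \<open>x\<close>.\<close>
        have "c + c' = - (of_rat (q + q') * x)"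
          using sum0 by (simp only: eq_neg_iff_add_eq_0)
        then have "of_rat (inverse (q + q')) * (c + c') = - (of_rat (inverse (q + q') * (q + q')) * x)"
          by (simp only: of_rat_mult mult_minus_right mult.assoc)
        then have "- x = of_rat (inverse (q + q')) * (c + c')"
          using False by simp
        also have "\<dots> \<in> K"
          using pos c by (intro Kq Kadd) simp_all
        finally show ?thesis
          using x by simp
      qed
    qed
    moreover have "K \<subseteq> X"
      using XI[of _ 0] by auto
    ultimately have "X = K"
      by (rule max)
    moreover have "x \<in> X"
      using XI[OF K0, of 1] by simp
    ultimately show ?thesis
      by simp
  qed
  then show ?thesis
    using Kadd Kneg by (intro exI[of _ K]) (auto simp: total_cone_def)
qed

lemma total_cone_max:
  assumes C: "total_cone C" and S: "finite S" "S \<noteq> {}"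
  shows "\<exists>m\<in>S. \<forall>s\<in>S. m - s \<in> C"
  using S
proof (induction S rule: finite_ne_induct)
  case (singleton x)
  then show ?case
    using total_coneD(3)[OF C, of 0] by simp
next
  case (insert x S)
  then obtain m where m: "m \<in> S" "\<And>s. s \<in> S \<Longrightarrow> m - s \<in> C"
    by blast
  show ?case
  proof (cases "m - x \<in> C")
    case True
    with m show ?thesis
      by blast
  next
    case False
    then have xm: "x - m \<in> C"
      using total_coneD(3)[OF C, of "x - m"] by simp
    have "x - s \<in> C" if "s \<in> S" for s
      using total_coneD(1)[OF C xm m(2)[OF that]] by simp
    moreover have "x - x \<in> C"
      using total_coneD(3)[OF C, of 0] by simp
    ultimately show ?thesis
      by blast
  qed
qed

lemma finite_TD_support: "finite {x. Poly_Mapping.lookup v (TD x) \<noteq> 0}"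
  and finite_TP_support: "finite {x. Poly_Mapping.lookup v (TP x) \<noteq> 0}"
proof -
  have "{x. Poly_Mapping.lookup v (TD x) \<noteq> 0} = TD -` Poly_Mapping.keys v"
    "{x. Poly_Mapping.lookup v (TP x) \<noteq> 0} = TP -` Poly_Mapping.keys v"
    by (auto simp: in_keys_iff)
  then show "finite {x. Poly_Mapping.lookup v (TD x) \<noteq> 0}" "finite {x. Poly_Mapping.lookup v (TP x) \<noteq> 0}"
    by (simp_all add: finite_vimageI inj_def)
qed

lemma total_cone_max_TP_support:
  assumes C: "total_cone C" and g: "g \<in> d1_P" "g \<noteq> 0"
  obtains M where "Poly_Mapping.lookup g (TP M) \<noteq> 0" "\<And>x. Poly_Mapping.lookup g (TP x) \<noteq> 0 \<Longrightarrow> M - x \<in> C"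
proof -
  have "{x. Poly_Mapping.lookup g (TP x) \<noteq> 0} \<noteq> {}"
  proof
    assume "{x. Poly_Mapping.lookup g (TP x) \<noteq> 0} = {}"
    then have "g = 0"
      using g(1) by (intro d1_eqI) (auto simp: d1_P_def)
    with g(2) show False
      by simp
  qed
  with total_cone_max[OF C finite_TP_support[of g]] that show ?thesis
    by blast
qed

context d1_pairing
begin

text \<open>A cone of the field is pulled back along \<open>d\<close>; injectivity of
  \<open>d\<close> keeps the preimage pointed.\<close>

lemma ex_total_cone_domain: "\<exists>C :: 'a set. total_cone C"
proof -
  obtain K :: "'f set" where K: "total_cone K"
    using ex_total_cone by blast
  have "total_cone {x. d x \<in> K}"
    using total_coneD(1,3)[OF K] total_coneD(2)[OF K, of "d _"] by (auto simp: total_cone_def)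
  then show ?thesis
    by blast
qed

lemma lookup_bracket_tD:
  "Poly_Mapping.lookup (d1_bracket d (tD x) w) (TD z) = (d z - 2 * d x) * Poly_Mapping.lookup w (TD (z - x))"
  "Poly_Mapping.lookup (d1_bracket d (tD x) w) (TP z) = (d z - d x) * Poly_Mapping.lookup w (TP (z - x))"
proof (induction w rule: d1_induct)
  case (tD y)
  show "Poly_Mapping.lookup (d1_bracket d (tD x) (tD y)) (TD z) = (d z - 2 * d x) * Poly_Mapping.lookup (tD y) (TD (z - x))"
    by (auto simp: d1_bracket_basis when_def)
  show "Poly_Mapping.lookup (d1_bracket d (tD x) (tD y)) (TP z) = (d z - d x) * Poly_Mapping.lookup (tD y) (TP (z - x))"
    by (simp add: d1_bracket_basis)
next
  case (tP y)
  show "Poly_Mapping.lookup (d1_bracket d (tD x) (tP y)) (TD z) = (d z - 2 * d x) * Poly_Mapping.lookup (tP y) (TD (z - x))"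
    by (simp add: d1_bracket_basis)
  show "Poly_Mapping.lookup (d1_bracket d (tD x) (tP y)) (TP z) = (d z - d x) * Poly_Mapping.lookup (tP y) (TP (z - x))"
    by (auto simp: d1_bracket_basis when_def)
qed (simp_all add: bracket_right lookup_add distrib_left mult.left_commute)

lemma bracket_tP_zero: "d1_bracket d v (tP 0) = 0"
  by (induction v rule: d1_induct) (simp_all add: bracket_left d1_bracket_basis)

subsection \<open>Abelian ideals\<close>

text \<open>Bracketing with \<open>\<partial>\<close> separates the components \<open>t\<^sup>x\<partial>\<close>, so an abelian ideal not inside \<open>d1_P\<close>
  would contain, modulo \<open>d1_P\<close>, some \<open>t\<^sup>x\<partial>\<close>, then \<open>\<partial>\<close>, and then every \<open>t\<^sup>y\<partial>\<close>.\<close>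

lemma abelian_ideal_subset_P:
  assumes diff: "\<And>v w. v \<in> I \<Longrightarrow> w \<in> I \<Longrightarrow> v - w \<in> I"
    and scale: "\<And>c v. v \<in> I \<Longrightarrow> d1_scale c v \<in> I"
    and ideal: "\<And>v w. w \<in> I \<Longrightarrow> d1_bracket d v w \<in> I"
    and abelian: "\<And>v w. v \<in> I \<Longrightarrow> w \<in> I \<Longrightarrow> d1_bracket d v w = 0"
  shows "I \<subseteq> d1_P"
proof (rule ccontr)
  assume "\<not> I \<subseteq> d1_P"
  then obtain v0 where v0: "v0 \<in> I \<and> v0 \<notin> d1_P"
    by blast
  let ?c = "\<lambda>v x. Poly_Mapping.lookup v (TD x)"
  define W where "W v = {x. ?c v x \<noteq> 0}" for v :: "('a, 'f) d1"
  have fin: "finite (W v)" for v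
    unfolding W_def by (rule finite_TD_support)
  \<comment> \<open>A member of \<open>I\<close> outside \<open>d1_P\<close> with the fewest
    \<open>TD\<close> components; minimality will leave only one.\<close>
  obtain u where u: "u \<in> I" "u \<notin> d1_P"
    and least: "\<And>w. w \<in> I \<Longrightarrow> w \<notin> d1_P \<Longrightarrow> card (W u) \<le> card (W w)"
    using ex_has_least_nat[of "\<lambda>v. v \<in> I \<and> v \<notin> d1_P" v0 "\<lambda>v. card (W v)", OF v0] by blast
  obtain x where x: "?c u x \<noteq> 0"
    using u(2) by (auto simp: d1_P_def)
  have single: "?c u y = 0" if "y \<noteq> x" for y
  proof (rule ccontr)
    assume y: "?c u y \<noteq> 0"
    \<comment> \<open>Bracketing with \<open>tD 0\<close> multiplies the component at
      \<open>TD z\<close> by \<open>d z\<close>. Subtracting \<open>d y\<close> times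
      \<open>u\<close> removes the component at \<open>y\<close> but keeps the one at
      \<open>x\<close>.\<close>
    define w where "w = d1_bracket d (tD 0) u - d1_scale (d y) u"
    have c: "?c w z = (d z - d y) * ?c u z" for z
      by (simp add: w_def lookup_minus lookup_bracket_tD algebra_simps)
    have "?c w x \<noteq> 0"
      using x that by (simp add: c)
    then have "w \<in> I" "w \<notin> d1_P"
      using u(1) diff scale ideal by (auto simp: w_def d1_P_def)
    then have "card (W u) \<le> card (W w)"
      by (rule least)
    moreover have "W w = W u - {y}"
      using c by (auto simp: W_def)
    moreover have "card (W u - {y}) < card (W u)"
      using y fin by (intro card_Diff1_less) (auto simp: W_def)
    ultimately show False
      by simp
  qed
  obtain u0 s where u0: "u0 \<in> I" "s \<noteq> 0" "\<And>z. ?c u0 z = (s when z = 0)"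
  proof (cases "x = 0")
    case True
    show ?thesis
      by (rule that[of u "?c u 0"]) (use True u(1) x single in \<open>auto simp: when_def\<close>)
  next
    case False
    \<comment> \<open>This bracket moves the exponent \<open>x\<close> to \<open>0\<close> with the
      factor \<open>2 * d x\<close>, which is nonzero in characteristic 0.\<close>
    let ?w = "d1_bracket d (tD (- x)) u"
    have "?c ?w z = (2 * d x * ?c u x when z = 0)" for z
      using single[of "z + x"] by (auto simp: lookup_bracket_tD when_def)
    then show ?thesis
      by (intro that[of ?w "2 * d x * ?c u x"]) (use False u(1) x ideal in simp_all)
  qed
  obtain y :: 'a where y: "y \<noteq> 0"
    using nontrivial by blast
  \<comment> \<open>Both \<open>u0\<close> and \<open>u1\<close> lie in \<open>I\<close>, yet their
    bracket has coefficient \<open>- (s * d y)^2\<close> at \<open>TD y\<close>; the part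
    \<open>p\<close> of \<open>u0\<close> contributes nothing there.\<close>
  define u1 where "u1 = d1_bracket d (tD y) u0"
  define p where "p = u0 - d1_scale s (tD 0)"
  have p: "p \<in> d1_P"
    by (auto simp: p_def d1_P_def u0(3) lookup_minus when_def)
  have "u0 = d1_scale s (tD 0) + p"
    by (simp add: p_def)
  then have "d1_bracket d u0 u1 = d1_scale s (d1_bracket d (tD 0) u1) + d1_bracket d p u1"
    by (simp add: bracket_left)
  moreover have "?c (d1_bracket d p u1) y = 0"
    using bracket_P_left[OF p, of u1] by (simp add: d1_P_def)
  ultimately have "?c (d1_bracket d u0 u1) y = s * (d y * (- d y * s))"
    by (simp add: lookup_add lookup_bracket_tD u1_def u0(3))
  moreover have "d1_bracket d u0 u1 = 0"
    using abelian ideal u0(1) by (simp add: u1_def)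
  ultimately show False
    using y u0(2) by simp
qed

section \<open>Automorphisms preserve the abelian ideal\<close>

lemma Aut_inv:
  assumes "f \<in> carrier (d1_Aut d)"
  obtains g where "g \<in> carrier (d1_Aut d)" "\<And>v. f (g v) = v" "\<And>v. g (f v) = v" "inv\<^bsub>d1_Aut d\<^esub> f = g"
proof -
  interpret G: group "d1_Aut d"
    by (rule group_Aut)
  have "f \<circ> inv\<^bsub>d1_Aut d\<^esub> f = id" "inv\<^bsub>d1_Aut d\<^esub> f \<circ> f = id"
    using G.r_inv[OF assms] G.l_inv[OF assms] by simp_all
  with that[of "inv\<^bsub>d1_Aut d\<^esub> f"] G.inv_closed[OF assms] show ?thesis
    by (simp add: fun_eq_iff)
qed

text \<open>The image of an abelian ideal under an automorphism is again an abelian ideal,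
  surjectivity letting it absorb arbitrary brackets. Hence \<open>abelian_ideal_subset_P\<close>
  applies to the image of \<open>d1_P\<close>.\<close>

lemma Aut_P_closed:
  assumes f: "f \<in> carrier (d1_Aut d)" and v: "v \<in> d1_P"
  shows "f v \<in> d1_P"
proof -
  obtain g where fg: "\<And>v. f (g v) = v"
    using Aut_inv[OF f] by blast
  have lin: "d1_linear f" and hom: "\<And>v w. f (d1_bracket d v w) = d1_bracket d (f v) (f w)"
    using f by (auto simp: in_carrier_Aut)
  note lin = d1_linearD[OF lin]
  have "f ` d1_P \<subseteq> d1_P"
  proof (rule abelian_ideal_subset_P)
    fix v w assume "w \<in> f ` d1_P"
    then obtain q where "w = f q" "q \<in> d1_P"
      by blast
    then have "d1_bracket d v w = f (d1_bracket d (g v) q)" "d1_bracket d (g v) q \<in> d1_P"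
      by (simp_all add: hom fg bracket_P_right)
    then show "d1_bracket d v w \<in> f ` d1_P"
      by blast
  next
    fix v w assume "v \<in> f ` d1_P" "w \<in> f ` d1_P"
    then obtain p q where pq: "v = f p" "w = f q" "p \<in> d1_P" "q \<in> d1_P"
      by blast
    then have "v - w = f (p - q)" "p - q \<in> d1_P"
      by (simp_all add: lin)
    then show "v - w \<in> f ` d1_P"
      by blast
    show "d1_bracket d v w = 0"
      using pq by (simp add: bracket_P_P lin flip: hom)
  next
    fix c v assume "v \<in> f ` d1_P"
    then obtain p where "v = f p" "p \<in> d1_P"
      by blast
    then have "d1_scale c v = f (d1_scale c p)" "d1_scale c p \<in> d1_P"
      by (simp_all add: lin)
    then show "d1_scale c v \<in> f ` d1_P"
      by blast
  qed
  with v show ?thesis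
    by blast
qed

text \<open>The \<open>TP\<close> part of \<open>v\<close> acts as zero on \<open>d1_P\<close>, so
  the bracket becomes a convolution over the \<open>TD\<close> support of \<open>v\<close>, where
  extreme exponents can be compared.\<close>

lemma lookup_bracket_P:
  assumes "w \<in> d1_P"
  shows "Poly_Mapping.lookup (d1_bracket d v w) (TP z) =
    (\<Sum>x\<in>{x. Poly_Mapping.lookup v (TD x) \<noteq> 0}.
      Poly_Mapping.lookup v (TD x) * ((d z - d x) * Poly_Mapping.lookup w (TP (z - x))))"
proof -
  let ?t = "\<lambda>u. Poly_Mapping.lookup v u * Poly_Mapping.lookup (d1_bracket d (Poly_Mapping.single u 1) w) (TP z)"
  have TP: "?t (TP x) = 0" for x
    using assms by (simp add: bracket_P_P flip: tP_def)
  have TD: "?t (TD x) = Poly_Mapping.lookup v (TD x) * ((d z - d x) * Poly_Mapping.lookup w (TP (z - x)))" for x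
    by (simp add: lookup_bracket_tD flip: tD_def)
  have "Poly_Mapping.lookup (d1_bracket d v w) (TP z) = (\<Sum>u\<in>Poly_Mapping.keys v. ?t u)"
    by (subst d1_linear_expand[OF d1_linear_bracket_left]) (simp add: lookup_sum)
  also have "\<dots> = (\<Sum>u\<in>TD ` {x. Poly_Mapping.lookup v (TD x) \<noteq> 0}. ?t u)"
  proof (rule sum.mono_neutral_right)
    show "\<forall>u\<in>Poly_Mapping.keys v - TD ` {x. Poly_Mapping.lookup v (TD x) \<noteq> 0}. ?t u = 0"
    proof
      fix u assume u: "u \<in> Poly_Mapping.keys v - TD ` {x. Poly_Mapping.lookup v (TD x) \<noteq> 0}"
      show "?t u = 0"
        using u TP by (cases u) (auto simp: in_keys_iff)
    qed
  qed (auto simp: in_keys_iff)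
  also have "\<dots> = (\<Sum>x\<in>{x. Poly_Mapping.lookup v (TD x) \<noteq> 0}. ?t (TD x))"
    by (subst sum.reindex) (simp_all add: inj_on_def)
  finally show ?thesis
    by (simp only: TD)
qed

subsection \<open>The image of \<open>\<partial>\<close>\<close>

text \<open>Compares the leading terms of both sides of the eigenvector equation.\<close>

lemma eigenvector_extreme:
  assumes C: "total_cone C" and g: "g \<in> d1_P" and eigen: "d1_bracket d v g = d1_scale c g" and c: "c \<noteq> 0"
    and m: "Poly_Mapping.lookup v (TD m) \<noteq> 0" "\<And>x. Poly_Mapping.lookup v (TD x) \<noteq> 0 \<Longrightarrow> m - x \<in> C"
    and M: "Poly_Mapping.lookup g (TP M) \<noteq> 0" "\<And>x. Poly_Mapping.lookup g (TP x) \<noteq> 0 \<Longrightarrow> M - x \<in> C"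
    and "M \<noteq> 0"
  shows "m = 0 \<and> c = Poly_Mapping.lookup v (TD 0) * d M"
proof -
  let ?S = "{x. Poly_Mapping.lookup v (TD x) \<noteq> 0}"
  have coeff: "c * Poly_Mapping.lookup g (TP z) =
    (\<Sum>x\<in>?S. Poly_Mapping.lookup v (TD x) * ((d z - d x) * Poly_Mapping.lookup g (TP (z - x))))" for z
    using arg_cong[OF eigen, of "\<lambda>w. Poly_Mapping.lookup w (TP z)"] by (simp add: lookup_bracket_P[OF g])
  have "c * Poly_Mapping.lookup g (TP M) \<noteq> 0"
    using c M(1) by simp
  \<comment> \<open>The coefficient at \<open>M\<close> is nonzero, so \<open>M\<close> splits as
    \<open>x + (M - x)\<close> over the two supports. Bounding the summands by \<open>m\<close> and
    \<open>M\<close> shows that \<open>m\<close> is nonnegative.\<close>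
  then obtain x where x: "Poly_Mapping.lookup v (TD x) \<noteq> 0" "Poly_Mapping.lookup g (TP (M - x)) \<noteq> 0"
    unfolding coeff by (auto elim: sum.not_neutral_contains_not_neutral)
  have "(m - x) + (M - (M - x)) \<in> C"
    by (intro total_coneD(1)[OF C] m(2) M(2) x)
  then have "m \<in> C"
    by simp
  \<comment> \<open>The largest exponent \<open>m + M\<close> arises in exactly one way, so no
    cancellation can occur there.\<close>
  have only: "Poly_Mapping.lookup v (TD x) * ((d (m + M) - d x) * Poly_Mapping.lookup g (TP (m + M - x))) = 0"
    if "x \<noteq> m" for x
  proof (rule ccontr)
    assume "\<not> ?thesis"
    then have "Poly_Mapping.lookup v (TD x) \<noteq> 0" "Poly_Mapping.lookup g (TP (m + M - x)) \<noteq> 0"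
      by auto
    then have "m - x \<in> C" "M - (m + M - x) \<in> C"
      by (blast intro: m(2) M(2))+
    then have "m - x = 0"
      using total_coneD(2)[OF C, of "m - x"] by simp
    with that show False
      by simp
  qed
  \<comment> \<open>The surviving term contains \<open>d M\<close>, nonzero because
    \<open>M \<noteq> 0\<close>. Thus \<open>m + M\<close> lies in the support of \<open>g\<close>,
    and maximality of \<open>M\<close> makes \<open>m\<close> nonpositive.\<close>
  have top: "c * Poly_Mapping.lookup g (TP (m + M)) = Poly_Mapping.lookup v (TD m) * (d M * Poly_Mapping.lookup g (TP M))"
    unfolding coeff
    by (subst sum.mono_neutral_right[of _ "{m}"]) (use only m(1) finite_TD_support in auto)
  then have "Poly_Mapping.lookup g (TP (m + M)) \<noteq> 0"
    using m(1) M(1) \<open>M \<noteq> 0\<close> by auto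
  then have "- m \<in> C"
    using M(2)[of "m + M"] by simp
  with \<open>m \<in> C\<close> C have "m = 0"
    by (blast dest: total_coneD(2))
  with top M(1) show ?thesis
    by simp
qed

text \<open>If the largest \<open>m\<close> in the support of \<open>v\<close> were nonzero, every eigenvector for a nonzero eigenvalue
  would have leading exponent \<open>0\<close> and lowest exponent \<open>L < 0\<close>, the eigenvalue being a fixed multiple of
  \<open>\<partial>(L)\<close>; this excludes opposite eigenvalues.\<close>

lemma eigenvector_pair_bound:
  assumes C: "total_cone C" and c: "c \<noteq> 0"
    and g: "g \<in> d1_P" "g \<noteq> 0" "d1_bracket d v g = d1_scale c g"
    and h: "h \<in> d1_P" "h \<noteq> 0" "d1_bracket d v h = d1_scale (- c) h"
    and x: "Poly_Mapping.lookup v (TD x) \<noteq> 0"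
  shows "- x \<in> C"
proof -
  let ?S = "{x. Poly_Mapping.lookup v (TD x) \<noteq> 0}"
  let ?C' = "{x. - x \<in> C}"
  have S: "?S \<noteq> {}"
    using x by blast
  note C' = total_cone_uminus[OF C]
  obtain m where m: "Poly_Mapping.lookup v (TD m) \<noteq> 0" "\<And>x. Poly_Mapping.lookup v (TD x) \<noteq> 0 \<Longrightarrow> m - x \<in> C"
    using total_cone_max[OF C finite_TD_support S] by blast
  obtain l where l: "Poly_Mapping.lookup v (TD l) \<noteq> 0" "\<And>x. Poly_Mapping.lookup v (TD x) \<noteq> 0 \<Longrightarrow> l - x \<in> ?C'"
    using total_cone_max[OF C' finite_TD_support S] by blast
  show ?thesis
  proof (cases "m = 0")
    case True
    then show ?thesis
      using m(2)[OF x] by simp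
  next
    case False
    \<comment> \<open>Since \<open>m \<noteq> 0\<close>, the cone \<open>C\<close> forces leading
      exponent 0. For the reversed cone the lowest exponent \<open>L\<close> is nonzero, so
      \<open>eigenvector_extreme\<close> yields \<open>l = 0\<close> and the eigenvalue.\<close>
    have bottom: "\<exists>L. - L \<in> C \<and> L \<noteq> 0 \<and> l = 0 \<and> k = Poly_Mapping.lookup v (TD 0) * d L"
      if k: "k \<noteq> 0" and w: "w \<in> d1_P" "w \<noteq> 0" "d1_bracket d v w = d1_scale k w" for k w
    proof -
      obtain M where M: "Poly_Mapping.lookup w (TP M) \<noteq> 0" "\<And>x. Poly_Mapping.lookup w (TP x) \<noteq> 0 \<Longrightarrow> M - x \<in> C"
        using total_cone_max_TP_support[OF C w(1,2)] by blast
      obtain L where L: "Poly_Mapping.lookup w (TP L) \<noteq> 0" "\<And>x. Poly_Mapping.lookup w (TP x) \<noteq> 0 \<Longrightarrow> L - x \<in> ?C'"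
        using total_cone_max_TP_support[OF C' w(1,2)] by blast
      have "M = 0"
        using eigenvector_extreme[OF C w(1,3) k m M] False by blast
      then have "- L \<in> C"
        using M(2)[OF L(1)] by simp
      \<comment> \<open>Otherwise both extremes are 0 and \<open>w\<close> is a multiple of the
        central element \<open>tP 0\<close>, against the nonzero eigenvalue.\<close>
      moreover have "L \<noteq> 0"
      proof
        assume "L = 0"
        then have "y = 0" if "Poly_Mapping.lookup w (TP y) \<noteq> 0" for y
          using total_coneD(2)[OF C, of y] M(2)[OF that] L(2)[OF that] \<open>M = 0\<close> by simp
        then have "w = d1_scale (Poly_Mapping.lookup w (TP 0)) (tP 0)"
          using w(1) by (intro d1_eqI) (auto simp: d1_P_def when_def)
        then have "d1_bracket d v w = 0"
          by (metis bracket_right(2) bracket_tP_zero d1.scale_zero_right)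
        with w k show False
          by simp
      qed
      ultimately show ?thesis
        using eigenvector_extreme[OF C' w(1,3) k l L] by blast
    qed
    obtain L where L: "- L \<in> C" "L \<noteq> 0" "l = 0" "c = Poly_Mapping.lookup v (TD 0) * d L"
      using bottom[OF c g] by blast
    obtain L' where L': "- L' \<in> C" "- c = Poly_Mapping.lookup v (TD 0) * d L'"
      using bottom[OF _ h] c by auto
    \<comment> \<open>Opposite eigenvalues force \<open>L' = - L\<close>, while both lowest
      exponents are negative: a contradiction.\<close>
    have "Poly_Mapping.lookup v (TD 0) * d (L + L') = 0"
      using L L' by (simp add: distrib_left flip: L(4) L'(2))
    then have "L + L' = 0"
      using l(1) L(3) by (simp del: d_add)
    then have "L' = - L"
      by (simp add: add_eq_0_iff)
    then show ?thesis
      using total_coneD(2)[OF C, of L] L L' by simp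
  qed
qed

text \<open>For \<open>y \<noteq> 0\<close> the vectors \<open>f (tP y)\<close> and
  \<open>f (tP (- y))\<close> are eigenvectors in \<open>d1_P\<close> for opposite nonzero
  eigenvalues. Using \<open>eigenvector_pair_bound\<close> for a cone and for its reverse bounds the
  support from both sides.\<close>

lemma Aut_tD_zero_support:
  assumes f: "f \<in> carrier (d1_Aut d)" and x: "Poly_Mapping.lookup (f (tD 0)) (TD x) \<noteq> 0"
  shows "x = 0"
proof -
  obtain C :: "'a set" where C: "total_cone C"
    using ex_total_cone_domain by blast
  obtain y :: 'a where y: "y \<noteq> 0"
    using nontrivial by blast
  obtain g where gf: "\<And>v. g (f v) = v" and g: "g \<in> carrier (d1_Aut d)"
    using Aut_inv[OF f] by blast
  have lin: "d1_linear f" and hom: "\<And>v w. f (d1_bracket d v w) = d1_bracket d (f v) (f w)"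
    using f by (auto simp: in_carrier_Aut)
  have eigen: "d1_bracket d (f (tD 0)) (f (tP z)) = d1_scale (d z) (f (tP z))" for z
    by (simp add: d1_bracket_basis d1_linearD[OF lin] flip: hom)
  have nz: "f (tP z) \<noteq> 0" for z
  proof
    have one: "Poly_Mapping.lookup (tP z :: ('a, 'f) d1) (TP z) = 1"
      by simp
    assume "f (tP z) = 0"
    then have "tP z = (0 :: ('a, 'f) d1)"
      using gf[of "tP z"] gf[of 0] d1_linearD(3)[OF lin] by simp
    then show False
      using one by simp
  qed
  note bound = eigenvector_pair_bound[OF _ _ Aut_P_closed[OF f d1_P_closed(2)] nz eigen
      Aut_P_closed[OF f d1_P_closed(2)] nz _ x, of _ y "- y"]
  have "- x \<in> C" "- x \<in> {x. - x \<in> C}"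
    using y by (intro bound C total_cone_uminus; simp add: eigen)+
  then show ?thesis
    using total_coneD(2)[OF C, of x] by simp
qed

end

subsection \<open>A functional equation\<close>

text \<open>After subtracting \<open>\<gamma> 0\<close> the deviation \<open>\<delta>\<close> is odd
  and satisfies the same equation. Two instances of it show that \<open>\<delta>\<close> is
  proportional to \<open>d\<close>.\<close>

lemma affine_of_functional_equation:
  fixes d \<gamma> :: "'a::ab_group_add \<Rightarrow> 'f::field_char_0"
  assumes additive: "\<And>x y. d (x + y) = d x + d y" and inj: "\<And>x. x \<noteq> 0 \<Longrightarrow> d x \<noteq> 0"
    and eq: "\<And>x y. (d y - d x) * \<gamma> (x + y) = d y * \<gamma> y - d x * \<gamma> x"
  shows "\<exists>b. \<forall>x. \<gamma> x = b * d x + \<gamma> 0"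
proof -
  define \<delta> where "\<delta> x = \<gamma> x - \<gamma> 0" for x
  have \<delta>0: "\<delta> 0 = 0"
    by (simp add: \<delta>_def)
  have eq': "(d y - d x) * \<delta> (x + y) = d y * \<delta> y - d x * \<delta> x" for x y
    using eq[of y x] by (simp add: \<delta>_def algebra_simps)
  have d_minus: "d (- x) = - d x" for x
    using additive[of x "- x"] additive[of 0 0] by (simp add: eq_neg_iff_add_eq_0 add.commute)
  have odd: "\<delta> (- x) = - \<delta> x" for x
  proof (cases "x = 0")
    case False
    have "d x * (\<delta> (- x) + \<delta> x) = 0"
      using eq'[of "- x" x] \<delta>0 by (simp add: d_minus algebra_simps)
    with inj[OF False] show ?thesis
      by (simp add: eq_neg_iff_add_eq_0)
  qed (simp add: \<delta>0)
  have cross: "d y * \<delta> x = d x * \<delta> y" for x y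
  proof (cases "y = 0")
    case False
    have 1: "(d y - d x) * \<delta> (x + y) = d y * \<delta> y - d x * \<delta> x"
      by (rule eq')
    \<comment> \<open>The pair \<open>- y\<close>, \<open>x + y\<close> has sum \<open>x\<close>, so
      this instance involves the same three values of \<open>\<delta>\<close>; eliminating
      \<open>\<delta> (x + y)\<close> leaves the cross relation.\<close>
    have 2: "(- d y - (d x + d y)) * \<delta> x = d y * \<delta> y - (d x + d y) * \<delta> (x + y)"
      using eq'[of "- y" "x + y"] by (simp add: d_minus odd additive)
    have "2 * d y * (d y * \<delta> x - d x * \<delta> y) = 0"
      using 1 2 by algebra
    with inj[OF False] show ?thesis
      by simp
  qed (use additive[of 0 0] \<delta>0 in simp)
  show ?thesis
  proof (cases "\<exists>y::'a. y \<noteq> 0")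
    case True
    then obtain y :: 'a where "d y \<noteq> 0"
      using inj by blast
    then have "\<gamma> x = \<delta> y / d y * d x + \<gamma> 0" for x
      using cross[of y x] by (simp add: \<delta>_def field_simps)
    then show ?thesis
      by blast
  next
    case False
    then show ?thesis
      using additive[of 0 0] by (metis add_0 mult_zero_left)
  qed
qed

subsection \<open>The subgroup \<open>aut_D1\<close>\<close>

lemma theta_linear: "d1_linear (theta d \<chi> \<epsilon> a b c)"
  by (simp add: theta_def d1_linear_lin_ext)

lemma theta_tD: "theta d \<chi> \<epsilon> a b c (tD x) =
    d1_scale (inverse \<epsilon> * \<chi> x) (tD (dil d \<epsilon> x)) + d1_scale ((b * d x + a) * \<chi> x) (tP (dil d \<epsilon> x))"
  and theta_tP: "theta d \<chi> \<epsilon> a b c (tP x) = d1_scale (c * \<chi> x) (tP (dil d \<epsilon> x))"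
  by (simp_all add: theta_def)

lemma charactersD:
  assumes "\<chi> \<in> characters"
  shows "\<chi> x \<noteq> 0" "\<chi> (x + y) = \<chi> x * \<chi> y" "\<chi> 0 = 1"
proof -
  show "\<chi> x \<noteq> 0" "\<chi> (x + y) = \<chi> x * \<chi> y" for x y
    using assms by (auto simp: characters_def)
  from this(1)[of 0] this(2)[of 0 0] show "\<chi> 0 = 1"
    by simp
qed

context d1_pairing
begin

text \<open>Invariance of \<open>range d\<close> supplies existence and injectivity of
  \<open>d\<close> uniqueness, so the definite description in \<open>dil\<close> denotes.\<close>

lemma d_dil [simp]:
  assumes "\<epsilon> \<in> dilations d"
  shows "d (dil d \<epsilon> x) = \<epsilon> * d x"
proof -
  have "\<epsilon> * d x \<in> range d"
    using assms by (auto simp: dilations_def)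
  then obtain y where "d y = \<epsilon> * d x"
    by auto
  then have "\<exists>!y. d y = \<epsilon> * d x"
    by (metis d_eq_iff)
  then show ?thesis
    unfolding dil_def by (rule theI')
qed

lemma dil_eqI: "\<epsilon> \<in> dilations d \<Longrightarrow> d y = \<epsilon> * d x \<Longrightarrow> dil d \<epsilon> x = y"
  by (metis d_dil d_eq_iff)

lemma dil_zero: "\<epsilon> \<in> dilations d \<Longrightarrow> dil d \<epsilon> 0 = 0"
  by (rule dil_eqI) simp_all

lemma dil_add: "\<epsilon> \<in> dilations d \<Longrightarrow> dil d \<epsilon> (x + y) = dil d \<epsilon> x + dil d \<epsilon> y"
  by (rule dil_eqI) (simp_all add: distrib_left)

lemma dil_one: "dil d 1 x = x"
  by (rule dil_eqI) (simp_all add: dilations_def)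

lemma dilations_nonzero: "\<epsilon> \<in> dilations d \<Longrightarrow> \<epsilon> \<noteq> 0"
  by (simp add: dilations_def)

lemma dilationsI:
  assumes "\<epsilon> \<noteq> 0" "\<And>x. \<exists>y. d y = \<epsilon> * d x" "\<And>x. \<exists>y. d x = \<epsilon> * d y"
  shows "\<epsilon> \<in> dilations d"
  using assms unfolding dilations_def by (auto simp: image_iff) (metis rangeI)

lemma dilations_one: "1 \<in> dilations d"
  by (simp add: dilations_def)

lemma dilationsE:
  assumes "\<epsilon> \<in> dilations d"
  obtains y where "d x = \<epsilon> * d y"
proof -
  have "d x \<in> (*) \<epsilon> ` range d"
    using assms by (simp add: dilations_def)
  with that show ?thesis
    by blast
qed

lemma dilations_mult:
  assumes "\<epsilon> \<in> dilations d" "\<epsilon>' \<in> dilations d"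
  shows "\<epsilon> * \<epsilon>' \<in> dilations d"
proof (rule dilationsI)
  show "\<epsilon> * \<epsilon>' \<noteq> 0"
    using assms by (simp add: dilations_nonzero)
  show "\<exists>y. d y = \<epsilon> * \<epsilon>' * d x" for x
    using assms by (intro exI[of _ "dil d \<epsilon> (dil d \<epsilon>' x)"]) simp
  show "\<exists>y. d x = \<epsilon> * \<epsilon>' * d y" for x
    by (metis assms dilationsE mult.assoc)
qed

lemma dilations_inverse:
  assumes "\<epsilon> \<in> dilations d"
  shows "inverse \<epsilon> \<in> dilations d"
proof (rule dilationsI)
  note [simp] = dilations_nonzero[OF assms]
  show "inverse \<epsilon> \<noteq> 0"
    by simp
  show "\<exists>y. d y = inverse \<epsilon> * d x" for x
    using dilationsE[OF assms, of x] by (metis \<open>\<epsilon> \<noteq> 0\<close> left_inverse mult.assoc mult_1)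
  show "\<exists>y. d x = inverse \<epsilon> * d y" for x
    using assms by (intro exI[of _ "dil d \<epsilon> x"]) simp
qed

lemma dil_dil:
  "\<epsilon> \<in> dilations d \<Longrightarrow> \<epsilon>' \<in> dilations d \<Longrightarrow> dil d \<epsilon>' (dil d \<epsilon> x) = dil d (\<epsilon>' * \<epsilon>) x"
  by (rule dil_eqI[symmetric]) (simp_all add: dilations_mult)

text \<open>For two \<open>tD\<close> arguments the \<open>TP\<close> coefficients agree because
  \<open>b * d x + a\<close> solves the equation of
  \<open>affine_of_functional_equation\<close>.\<close>

lemma theta_hom:
  assumes \<chi>: "\<chi> \<in> characters" and \<epsilon>: "\<epsilon> \<in> dilations d"
  shows "theta d \<chi> \<epsilon> a b c (d1_bracket d v w) = d1_bracket d (theta d \<chi> \<epsilon> a b c v) (theta d \<chi> \<epsilon> a b c w)"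
proof (rule bracket_hom_basisI[OF theta_linear])
  let ?\<theta> = "theta d \<chi> \<epsilon> a b c"
  note lin = d1_linearD[OF theta_linear]
  have [simp]: "\<epsilon> \<noteq> 0"
    using \<epsilon> by (rule dilations_nonzero)
  show "?\<theta> (d1_bracket d (tD x) (tD y)) = d1_bracket d (?\<theta> (tD x)) (?\<theta> (tD y))" for x y
    by (rule d1_eqI)
      (auto simp: d1_bracket_basis theta_tD lin bracket_left bracket_right lookup_add lookup_minus
        dil_add[OF \<epsilon>] charactersD(2)[OF \<chi>] \<epsilon> when_def field_simps)
  show DP: "?\<theta> (d1_bracket d (tD x) (tP y)) = d1_bracket d (?\<theta> (tD x)) (?\<theta> (tP y))" for x y
    by (rule d1_eqI)
      (auto simp: d1_bracket_basis theta_tD theta_tP lin bracket_left bracket_right lookup_add lookup_minus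
        dil_add[OF \<epsilon>] charactersD(2)[OF \<chi>] \<epsilon> when_def field_simps)
  show "?\<theta> (d1_bracket d (tP y) (tD x)) = d1_bracket d (?\<theta> (tP y)) (?\<theta> (tD x))" for x y
    by (subst (1 2) bracket_antisym) (simp add: lin DP)
  show "?\<theta> (d1_bracket d (tP x) (tP y)) = d1_bracket d (?\<theta> (tP x)) (?\<theta> (tP y))" for x y
    by (simp add: d1_bracket_basis theta_tP lin bracket_left bracket_right)
qed

text \<open>In the new \<open>TP\<close> coefficient the factor \<open>inverse \<epsilon>\<close>
  cancels the \<open>\<epsilon>\<close> of \<open>d (dil d \<epsilon> x)\<close>. Hence
  \<open>b'\<close> enters unscaled while \<open>a'\<close> keeps
  \<open>inverse \<epsilon>\<close>.\<close>

lemma theta_comp: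
  assumes \<chi>: "\<chi> \<in> characters" "\<chi>' \<in> characters" and \<epsilon>: "\<epsilon> \<in> dilations d" "\<epsilon>' \<in> dilations d"
  shows "theta d \<chi>' \<epsilon>' a' b' c' \<circ> theta d \<chi> \<epsilon> a b c =
    theta d (\<lambda>x. \<chi>' (dil d \<epsilon> x) * \<chi> x) (\<epsilon>' * \<epsilon>) (a' * inverse \<epsilon> + c' * a) (b' + c' * b) (c' * c)"
    (is "?L = ?R")
proof
  fix v
  have [simp]: "\<epsilon> \<noteq> 0" "\<epsilon>' \<noteq> 0"
    using \<epsilon> by (simp_all add: dilations_nonzero)
  note lin = d1_linearD[OF theta_linear]
  show "?L v = ?R v"
  proof (rule d1_linear_eqI[of ?L ?R])
    show "d1_linear ?L"
      by (rule d1_linearI) (simp_all add: lin)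
    show "d1_linear ?R"
      by (rule theta_linear)
    show "?L (tD x) = ?R (tD x)" for x
      by (rule d1_eqI) (auto simp: lin theta_tD theta_tP dil_dil \<epsilon> lookup_add when_def field_simps)
    show "?L (tP x) = ?R (tP x)" for x
      by (simp add: lin theta_tP dil_dil \<epsilon> mult_ac)
  qed
qed

lemma theta_one: "theta d (\<lambda>x. 1) 1 0 0 1 = id"
proof
  fix v
  show "theta d (\<lambda>x. 1) 1 0 0 1 v = id v"
  proof (rule d1_linear_eqI[OF theta_linear])
    show "d1_linear id"
      by (rule d1_linearI) simp_all
  qed (simp_all add: theta_tD theta_tP dil_one)
qed

lemma characters_comp:
  assumes "\<chi> \<in> characters" "\<chi>' \<in> characters" "\<epsilon> \<in> dilations d"
  shows "(\<lambda>x. \<chi>' (dil d \<epsilon> x) * \<chi> x) \<in> characters"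
  using assms by (simp add: characters_def dil_add)

lemma theta_inverse:
  assumes \<chi>: "\<chi> \<in> characters" and \<epsilon>: "\<epsilon> \<in> dilations d" and c: "c \<noteq> 0"
  obtains \<chi>' a' b' where "\<chi>' \<in> characters"
    "theta d \<chi>' (inverse \<epsilon>) a' b' (inverse c) \<circ> theta d \<chi> \<epsilon> a b c = id"
    "theta d \<chi> \<epsilon> a b c \<circ> theta d \<chi>' (inverse \<epsilon>) a' b' (inverse c) = id"
proof -
  define \<chi>' where "\<chi>' x = inverse (\<chi> (dil d (inverse \<epsilon>) x))" for x
  note \<epsilon>' = dilations_inverse[OF \<epsilon>]
  have \<epsilon>0: "\<epsilon> \<noteq> 0"
    using \<epsilon> by (rule dilations_nonzero)
  have \<chi>': "\<chi>' \<in> characters"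
    using \<chi> \<epsilon>' by (simp add: characters_def \<chi>'_def dil_add)
  have "\<chi>' (dil d \<epsilon> x) * \<chi> x = 1" "\<chi> (dil d (inverse \<epsilon>) x) * \<chi>' x = 1" for x
    using charactersD(1)[OF \<chi>] \<epsilon>0 by (simp_all add: \<chi>'_def dil_dil \<epsilon> \<epsilon>' dil_one)
  \<comment> \<open>The values \<open>- \<epsilon> * a / c\<close> and \<open>- b / c\<close> solve
    the equations that \<open>theta_comp\<close> gives for vanishing additive parameters.\<close>
  with theta_comp[OF \<chi> \<chi>' \<epsilon> \<epsilon>', of "- \<epsilon> * a / c" "- b / c" "inverse c" a b c]
    theta_comp[OF \<chi>' \<chi> \<epsilon>' \<epsilon>, of a b c "- \<epsilon> * a / c" "- b / c" "inverse c"] c \<epsilon>0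
  show ?thesis
    by (intro that[OF \<chi>', of "- \<epsilon> * a / c" "- b / c"]) (simp_all add: theta_one field_simps)
qed

lemma aut_D1_subset: "aut_D1 d \<subseteq> carrier (d1_Aut d)"
proof
  fix f assume "f \<in> aut_D1 d"
  then obtain \<chi> \<epsilon> a b c where f: "f = theta d \<chi> \<epsilon> a b c" "\<chi> \<in> characters" "\<epsilon> \<in> dilations d" "c \<noteq> 0"
    by (auto simp: aut_D1_def)
  from theta_inverse[OF f(2-4), of a b] have "bij f"
    unfolding f(1) by (metis bij_of_comp_id)
  then show "f \<in> carrier (d1_Aut d)"
    using f by (simp add: in_carrier_Aut theta_linear theta_hom)
qed

lemma aut_D1_subgroup: "subgroup (aut_D1 d) (d1_Aut d)"
proof (rule group.subgroupI[OF group_Aut aut_D1_subset])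
  have "theta d (\<lambda>x. 1) 1 0 0 1 \<in> aut_D1 d"
    unfolding aut_D1_def using dilations_one by (force simp: characters_def)
  then show "aut_D1 d \<noteq> {}"
    by blast
next
  fix f assume f: "f \<in> aut_D1 d"
  then obtain \<chi> \<epsilon> a b c where f_eq: "f = theta d \<chi> \<epsilon> a b c" "\<chi> \<in> characters" "\<epsilon> \<in> dilations d" "c \<noteq> 0"
    by (auto simp: aut_D1_def)
  obtain \<chi>' a' b' where \<chi>': "\<chi>' \<in> characters" "theta d \<chi>' (inverse \<epsilon>) a' b' (inverse c) \<circ> f = id"
    using theta_inverse[OF f_eq(2-4), of a b] unfolding f_eq(1) by blast
  have g: "theta d \<chi>' (inverse \<epsilon>) a' b' (inverse c) \<in> aut_D1 d"
    using \<chi>'(1) dilations_inverse[OF f_eq(3)] f_eq(4) nonzero_imp_inverse_nonzero[of c]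
    unfolding aut_D1_def by blast
  with \<chi>'(2) f aut_D1_subset have "inv\<^bsub>d1_Aut d\<^esub> f = theta d \<chi>' (inverse \<epsilon>) a' b' (inverse c)"
    by (intro inv_Aut) auto
  with g show "inv\<^bsub>d1_Aut d\<^esub> f \<in> aut_D1 d"
    by simp
next
  fix f g assume "f \<in> aut_D1 d" "g \<in> aut_D1 d"
  then obtain \<chi> \<epsilon> a b c \<chi>' \<epsilon>' a' b' c'
    where f: "f = theta d \<chi>' \<epsilon>' a' b' c'" "\<chi>' \<in> characters" "\<epsilon>' \<in> dilations d" "c' \<noteq> 0"
      and g: "g = theta d \<chi> \<epsilon> a b c" "\<chi> \<in> characters" "\<epsilon> \<in> dilations d" "c \<noteq> 0"
    by (auto simp: aut_D1_def)
  have "c' * c \<noteq> 0"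
    using f g by simp
  then show "f \<otimes>\<^bsub>d1_Aut d\<^esub> g \<in> aut_D1 d"
    using characters_comp[OF g(2) f(2) g(3)] dilations_mult[OF f(3) g(3)]
    unfolding mult_Aut f(1) g(1) theta_comp[OF g(2) f(2) g(3) f(3)] aut_D1_def by blast
qed

section \<open>Normality and trivial intersection\<close>

lemma bracket_tP_zero_left: "d1_bracket d (tP 0) v = 0"
  by (subst bracket_antisym) (simp add: bracket_tP_zero)

lemma lookup_bracket_tD_zero_right:
  "Poly_Mapping.lookup (d1_bracket d q (tD 0)) (TP z) = - (d z * Poly_Mapping.lookup q (TP z))"
  by (subst bracket_antisym) (simp add: lookup_bracket_tD)

text \<open>Conjugating the shear along \<open>q\<close> by \<open>f\<close> gives the shear along
  \<open>f q\<close>, and \<open>f q\<close> stays in \<open>d1_P\<close>.\<close>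

lemma shear_normal: "d1_shear d ` d1_P \<lhd> d1_Aut d"
  unfolding group.normal_inv_iff[OF group_Aut]
proof (intro conjI ballI shear_subgroup)
  fix f e assume f: "f \<in> carrier (d1_Aut d)" and "e \<in> d1_shear d ` d1_P"
  then obtain q where q: "e = d1_shear d q" "q \<in> d1_P"
    by blast
  obtain g where g: "\<And>v. f (g v) = v" "inv\<^bsub>d1_Aut d\<^esub> f = g"
    using Aut_inv[OF f] by blast
  have "f \<circ> e \<circ> g = d1_shear d (f q)"
    using f g(1) by (auto simp: fun_eq_iff q(1) d1_shear_def in_carrier_Aut d1_linearD)
  then show "f \<otimes>\<^bsub>d1_Aut d\<^esub> e \<otimes>\<^bsub>d1_Aut d\<^esub> inv\<^bsub>d1_Aut d\<^esub> f \<in> d1_shear d ` d1_P"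
    using Aut_P_closed[OF f q(2)] g(2) by simp
qed

text \<open>The two descriptions of \<open>f (tD 0)\<close> are compared: a \<open>theta\<close> map
  adds only a multiple of \<open>tP 0\<close>, so \<open>q\<close> has no other component and is
  central.\<close>

lemma shear_inter_aut_D1:
  assumes "f \<in> d1_shear d ` d1_P" "f \<in> aut_D1 d"
  shows "f = id"
proof -
  obtain q where q: "f = d1_shear d q" "q \<in> d1_P"
    using assms(1) by blast
  obtain \<chi> \<epsilon> a b c where f: "f = theta d \<chi> \<epsilon> a b c" "\<epsilon> \<in> dilations d"
    using assms(2) by (auto simp: aut_D1_def)
  have "Poly_Mapping.lookup q (TP z) = 0" if "z \<noteq> 0" for z
  proof -
    have "Poly_Mapping.lookup (f (tD 0)) (TP z) = 0"
      using that by (simp add: f(1) theta_tD dil_zero[OF f(2)] lookup_add)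
    moreover have "Poly_Mapping.lookup (f (tD 0)) (TP z) = - (d z * Poly_Mapping.lookup q (TP z))"
      by (simp add: q(1) d1_shear_def lookup_add lookup_bracket_tD_zero_right)
    ultimately show ?thesis
      using that by simp
  qed
  then have "q = d1_scale (Poly_Mapping.lookup q (TP 0)) (tP 0)"
    using q(2) by (intro d1_eqI) (auto simp: d1_P_def when_def)
  then have "d1_bracket d q v = 0" for v
    by (metis bracket_left(2) bracket_tP_zero_left d1.scale_zero_right)
  then show ?thesis
    by (simp add: q(1) d1_shear_def fun_eq_iff)
qed

subsection \<open>Decomposition of an automorphism\<close>

lemma shear_normalizes_tD_zero:
  assumes f: "f \<in> carrier (d1_Aut d)"
  obtains q s a where "q \<in> d1_P" "s \<noteq> 0"
    "d1_shear d q (f (tD 0)) = d1_scale s (tD 0) + d1_scale a (tP 0)"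
proof -
  define v where "v = f (tD 0)"
  define s where "s = Poly_Mapping.lookup v (TD 0)"
  have v_TD: "Poly_Mapping.lookup v (TD z) = (s when z = 0)" for z
    using Aut_tD_zero_support[OF f, of z] by (auto simp: when_def s_def v_def)
  \<comment> \<open>Otherwise \<open>f (tD 0)\<close> lies in \<open>d1_P\<close>, and the inverse
    automorphism would carry \<open>tD 0\<close> into \<open>d1_P\<close>.\<close>
  have "s \<noteq> 0"
  proof
    assume "s = 0"
    then have "v \<in> d1_P"
      by (simp add: d1_P_def v_TD)
    moreover obtain g where "g \<in> carrier (d1_Aut d)" "g v = tD 0"
      using Aut_inv[OF f] unfolding v_def by metis
    ultimately have "(tD 0 :: ('a, 'f) d1) \<in> d1_P"
      using Aut_P_closed by metis
    moreover have "Poly_Mapping.lookup (tD 0 :: ('a, 'f) d1) (TD 0) = 1"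
      by simp
    ultimately show False
      by (simp add: d1_P_def del: lookup_tD)
  qed
  define p where "p = v - d1_scale s (tD 0)"
  have p: "p \<in> d1_P"
    by (auto simp: p_def d1_P_def lookup_minus v_TD when_def)
  \<comment> \<open>Cancelling \<open>p\<close> at exponent \<open>z\<close> requires
    \<open>s * d z\<close> times the coefficient of \<open>q\<close> to equal that of
    \<open>p\<close>. At \<open>z = 0\<close> the inverse is 0 by convention, so the
    \<open>tP 0\<close> component survives.\<close>
  define h where "h = (\<lambda>u. case u of TD _ \<Rightarrow> (0 :: ('a, 'f) d1) | TP z \<Rightarrow> d1_scale (inverse (s * d z)) (tP z))"
  define q where "q = lin_ext h p"
  have "lin_ext h w \<in> d1_P \<and> Poly_Mapping.lookup (lin_ext h w) (TP z) = inverse (s * d z) * Poly_Mapping.lookup w (TP z)" for w z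
    by (induction w rule: d1_induct)
      (simp_all add: d1_linearD[OF d1_linear_lin_ext] lookup_add distrib_left mult.left_commute,
       auto simp: h_def when_def)
  then have q: "q \<in> d1_P" "Poly_Mapping.lookup q (TP z) = inverse (s * d z) * Poly_Mapping.lookup p (TP z)" for z
    unfolding q_def by blast+
  have v: "v = d1_scale s (tD 0) + p"
    by (simp add: p_def)
  have v_TP: "Poly_Mapping.lookup v (TP z) = Poly_Mapping.lookup p (TP z)" for z
    by (simp add: v lookup_add)
  have "d1_shear d q v = d1_scale s (tD 0) + d1_scale (Poly_Mapping.lookup p (TP 0)) (tP 0)"
  proof (rule d1_eqI)
    fix z
    have "d1_shear d q v = v + d1_scale s (d1_bracket d q (tD 0))"
      by (simp add: d1_shear_def v bracket_right bracket_P_P p q(1))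
    note eq = this
    have "d1_bracket d q (tD 0) \<in> d1_P"
      by (rule bracket_P_left[OF q(1)])
    then show "Poly_Mapping.lookup (d1_shear d q v) (TD z) =
        Poly_Mapping.lookup (d1_scale s (tD 0) + d1_scale (Poly_Mapping.lookup p (TP 0)) (tP 0)) (TD z)"
      by (auto simp: eq lookup_add v_TD d1_P_def when_def)
    show "Poly_Mapping.lookup (d1_shear d q v) (TP z) =
        Poly_Mapping.lookup (d1_scale s (tD 0) + d1_scale (Poly_Mapping.lookup p (TP 0)) (tP 0)) (TP z)"
      using \<open>s \<noteq> 0\<close> by (auto simp: eq v_TP lookup_add lookup_bracket_tD_zero_right q(2) when_def field_simps)
  qed
  with that q(1) \<open>s \<noteq> 0\<close> show ?thesis
    unfolding v_def by blast
qed

text \<open>Since \<open>tP 0\<close> is central, \<open>f\<close> intertwines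
  \<open>ad (tD 0)\<close> with its multiple by \<open>s\<close>. So \<open>f\<close> maps basis
  vectors to eigenvectors, whose exponents are those of the dilation by
  \<open>inverse s\<close>.\<close>

lemma Aut_normalized_in_aut_D1:
  assumes f: "f \<in> carrier (d1_Aut d)" and s: "s \<noteq> 0"
    and f0: "f (tD 0) = d1_scale s (tD 0) + d1_scale a (tP 0)"
  shows "f \<in> aut_D1 d"
proof -
  obtain g where g: "g \<in> carrier (d1_Aut d)" and fg: "\<And>v. f (g v) = v" and gf: "\<And>v. g (f v) = v"
    using Aut_inv[OF f] by blast
  have lin: "d1_linear f" and hom: "\<And>v w. f (d1_bracket d v w) = d1_bracket d (f v) (f w)"
    using f by (auto simp: in_carrier_Aut)
  note lin' = d1_linearD[OF lin]
  have ad0: "d1_bracket d (f (tD 0)) w = d1_scale s (d1_bracket d (tD 0) w)" for w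
    by (simp add: f0 bracket_left bracket_tP_zero_left)
  have ad0_f: "d1_scale s (d1_bracket d (tD 0) (f w)) = f (d1_bracket d (tD 0) w)" for w
    by (simp add: hom ad0)
  have eigD: "d1_scale s (d1_bracket d (tD 0) (f (tD x))) = d1_scale (d x) (f (tD x))"
    and eigP: "d1_scale s (d1_bracket d (tD 0) (f (tP x))) = d1_scale (d x) (f (tP x))" for x
    by (simp_all add: ad0_f d1_bracket_basis lin')
  have supp: "s * d z = d x"
    if "d1_scale s (d1_bracket d (tD 0) w) = d1_scale (d x) w"
      "Poly_Mapping.lookup w (TD z) \<noteq> 0 \<or> Poly_Mapping.lookup w (TP z) \<noteq> 0" for w x z
    using that(2) arg_cong[OF that(1), of "\<lambda>w. Poly_Mapping.lookup w (TD z)"]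
      arg_cong[OF that(1), of "\<lambda>w. Poly_Mapping.lookup w (TP z)"]
    by (auto simp: lookup_bracket_tD)
  \<comment> \<open>Stated for every automorphism because it serves for \<open>f\<close> and for its
    inverse \<open>g\<close>, one for each inclusion in the dilation condition.\<close>
  have tP_nz: "\<exists>z. Poly_Mapping.lookup (h (tP x)) (TP z) \<noteq> 0" if h: "h \<in> carrier (d1_Aut d)" for h x
  proof (rule ccontr)
    assume "\<not> ?thesis"
    then have "h (tP x) = 0"
      using Aut_P_closed[OF h d1_P_closed(2)] by (intro d1_eqI) (auto simp: d1_P_def)
    moreover have "h 0 = 0" "inj h"
      using h by (auto simp: in_carrier_Aut d1_linearD(3) bij_is_inj)
    ultimately have "tP x = (0 :: ('a, 'f) d1)"
      by (metis injD)
    moreover have "Poly_Mapping.lookup (tP x :: ('a, 'f) d1) (TP x) = 1"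
      by simp
    ultimately show False
      by simp
  qed

  define \<epsilon> where "\<epsilon> = inverse s"
  have \<epsilon>: "\<epsilon> \<in> dilations d"
  proof (rule dilationsI)
    show "\<epsilon> \<noteq> 0"
      using s by (simp add: \<epsilon>_def)
    fix x
    obtain z where "Poly_Mapping.lookup (f (tP x)) (TP z) \<noteq> 0"
      using tP_nz[OF f] by blast
    then have "s * d z = d x"
      using supp[OF eigP] by blast
    then show "\<exists>y. d y = \<epsilon> * d x"
      using s by (intro exI[of _ z]) (simp add: \<epsilon>_def field_simps)
    obtain y where y: "Poly_Mapping.lookup (g (tP x)) (TP y) \<noteq> 0"
      using tP_nz[OF g] by blast
    \<comment> \<open>Pulled back by \<open>g\<close>, \<open>tP x\<close> is an eigenvector of
      \<open>ad (tD 0)\<close> with eigenvalue \<open>s * d x\<close>; any exponent \<open>y\<close>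
      in its support is the required preimage.\<close>
    have "f (d1_bracket d (tD 0) (g (tP x))) = f (d1_scale (s * d x) (g (tP x)))"
      by (simp add: lin' fg d1_bracket_basis flip: ad0_f)
    then have "d1_bracket d (tD 0) (g (tP x)) = d1_scale (s * d x) (g (tP x))"
      by (metis gf)
    from arg_cong[OF this, of "\<lambda>w. Poly_Mapping.lookup w (TP y)"] y have "d y = s * d x"
      by (simp add: lookup_bracket_tD)
    then show "\<exists>y. d x = \<epsilon> * d y"
      using s by (intro exI[of _ y]) (simp add: \<epsilon>_def)
  qed
  have dil: "z = dil d \<epsilon> x" if "s * d z = d x" for x z
    using that s by (intro dil_eqI[OF \<epsilon>, symmetric]) (simp add: \<epsilon>_def field_simps)

  define \<alpha> where "\<alpha> x = Poly_Mapping.lookup (f (tD x)) (TD (dil d \<epsilon> x))" for x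
  define \<beta> where "\<beta> x = Poly_Mapping.lookup (f (tD x)) (TP (dil d \<epsilon> x))" for x
  define c where "c x = Poly_Mapping.lookup (f (tP x)) (TP (dil d \<epsilon> x))" for x
  have fD: "f (tD x) = d1_scale (\<alpha> x) (tD (dil d \<epsilon> x)) + d1_scale (\<beta> x) (tP (dil d \<epsilon> x))" for x
  proof (rule d1_eqI)
    fix z
    show "Poly_Mapping.lookup (f (tD x)) (TD z) =
        Poly_Mapping.lookup (d1_scale (\<alpha> x) (tD (dil d \<epsilon> x)) + d1_scale (\<beta> x) (tP (dil d \<epsilon> x))) (TD z)"
      using dil[OF supp[OF eigD, of x z]] by (auto simp: lookup_add \<alpha>_def when_def)
    show "Poly_Mapping.lookup (f (tD x)) (TP z) =
        Poly_Mapping.lookup (d1_scale (\<alpha> x) (tD (dil d \<epsilon> x)) + d1_scale (\<beta> x) (tP (dil d \<epsilon> x))) (TP z)"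
      using dil[OF supp[OF eigD, of x z]] by (auto simp: lookup_add \<beta>_def when_def)
  qed
  have fP: "f (tP x) = d1_scale (c x) (tP (dil d \<epsilon> x))" for x
  proof (rule d1_eqI)
    fix z
    show "Poly_Mapping.lookup (f (tP x)) (TD z) = Poly_Mapping.lookup (d1_scale (c x) (tP (dil d \<epsilon> x))) (TD z)"
      using Aut_P_closed[OF f d1_P_closed(2)] by (simp add: d1_P_def)
    show "Poly_Mapping.lookup (f (tP x)) (TP z) = Poly_Mapping.lookup (d1_scale (c x) (tP (dil d \<epsilon> x))) (TP z)"
      using dil[OF supp[OF eigP, of x z]] by (auto simp: lookup_add c_def when_def)
  qed
  have c_nz: "c x \<noteq> 0" for x
    using tP_nz[OF f, of x] by (auto simp: fP)

  \<comment> \<open>Chosen so that \<open>\<alpha> x\<close> becomes the coefficient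
    \<open>inverse \<epsilon> * \<chi> x\<close> of \<open>theta\<close>.\<close>
  define \<chi> where "\<chi> x = \<epsilon> * \<alpha> x" for x
  \<comment> \<open>Comparing coefficients gives this relation multiplied by \<open>d y\<close>,
    which can be cancelled for \<open>y \<noteq> 0\<close>.\<close>
  have c_rel: "c (x + y) = \<chi> x * c y" if "y \<noteq> 0" for x y
  proof -
    have "d1_scale (d y) (f (tP (x + y))) = d1_bracket d (f (tD x)) (f (tP y))"
      by (simp add: d1_bracket_basis lin' flip: hom)
    from arg_cong[OF this, of "\<lambda>w. Poly_Mapping.lookup w (TP (dil d \<epsilon> (x + y)))"]
    have "d y * c (x + y) = \<alpha> x * (c y * (\<epsilon> * d y))"
      by (simp add: fD fP bracket_left bracket_right d1_bracket_basis dil_add \<epsilon> mult_ac)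
    with that show ?thesis
      by (simp add: \<chi>_def mult_ac)
  qed
  have \<chi>_nz: "\<chi> x \<noteq> 0" for x
    using nontrivial c_rel[of _ x] c_nz[of "x + _"] by fastforce
  have \<chi>_add: "\<chi> (x + y) = \<chi> x * \<chi> y" for x y
  proof -
    \<comment> \<open>\<open>c_rel\<close> is applied at \<open>z\<close> and at
      \<open>y + z\<close>, so both must be nonzero. For \<open>y \<noteq> 0\<close> the choice
      \<open>z = y\<close> works because \<open>2 * d y\<close> is nonzero.\<close>
    obtain z where z: "z \<noteq> 0" "y + z \<noteq> 0"
    proof (cases "y = 0")
      case False
      then have "d (y + y) \<noteq> 0"
        by simp
      then have "y + y \<noteq> 0"
        by (metis d_zero)
      with that False show ?thesis
        by blast
    qed (use nontrivial that in auto)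
    have "\<chi> (x + y) * c z = \<chi> x * \<chi> y * c z"
      using c_rel[OF z(1), of "x + y"] c_rel[OF z(2), of x] c_rel[OF z(1), of y] by (auto simp: add.assoc)
    with c_nz show ?thesis
      by simp
  qed
  have \<chi>: "\<chi> \<in> characters"
    using \<chi>_nz \<chi>_add by (simp add: characters_def)
  have c_eq: "c y = c 0 * \<chi> y" for y
  proof (cases "y = 0")
    case False
    have "c 0 = \<chi> (- y) * c y" "\<chi> (- y) * \<chi> y = 1"
      using c_rel[OF False, of "- y"] \<chi>_add[of "- y" y] charactersD(3)[OF \<chi>] by simp_all
    then show ?thesis
      by (simp add: mult.assoc mult.commute mult.left_commute)
  qed (simp add: charactersD(3)[OF \<chi>])

  \<comment> \<open>Dividing out the character turns the relation from \<open>[tD x, tD y]\<close>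
    into the equation of \<open>affine_of_functional_equation\<close>.\<close>
  define \<gamma> where "\<gamma> x = \<beta> x / \<chi> x" for x
  have \<beta>: "\<beta> x = \<gamma> x * \<chi> x" for x
    using \<chi>_nz by (simp add: \<gamma>_def)
  have "(d y - d x) * \<gamma> (x + y) = d y * \<gamma> y - d x * \<gamma> x" for x y
  proof -
    have "d1_scale (d y - d x) (f (tD (x + y))) = d1_bracket d (f (tD x)) (f (tD y))"
      by (simp add: d1_bracket_basis lin' flip: hom)
    from arg_cong[OF this, of "\<lambda>w. Poly_Mapping.lookup w (TP (dil d \<epsilon> (x + y)))"]
    have "(d y - d x) * \<beta> (x + y) = \<alpha> x * (\<beta> y * (\<epsilon> * d y)) - \<alpha> y * (\<beta> x * (\<epsilon> * d x))"
      by (simp add: fD bracket_left bracket_right d1_bracket_basis dil_add \<epsilon> lookup_add lookup_minus add.commute algebra_simps)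
    then have "\<chi> x * \<chi> y * ((d y - d x) * \<gamma> (x + y)) = \<chi> x * \<chi> y * (d y * \<gamma> y - d x * \<gamma> x)"
      unfolding \<beta> \<chi>_add by (simp add: \<chi>_def algebra_simps)
    with \<chi>_nz show ?thesis
      by simp
  qed
  then obtain b where b: "\<And>x. \<gamma> x = b * d x + \<gamma> 0"
    using affine_of_functional_equation[of d \<gamma>] additive nondegenerate by blast
  have "f v = theta d \<chi> \<epsilon> (\<gamma> 0) b (c 0) v" for v
  proof (rule d1_linear_eqI[OF lin theta_linear])
    show "f (tD x) = theta d \<chi> \<epsilon> (\<gamma> 0) b (c 0) (tD x)" for x
      using dilations_nonzero[OF \<epsilon>] by (simp add: fD theta_tD \<beta> \<chi>_def flip: b)
    show "f (tP x) = theta d \<chi> \<epsilon> (\<gamma> 0) b (c 0) (tP x)" for x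
      by (simp add: fP theta_tP flip: c_eq)
  qed
  then have "f = theta d \<chi> \<epsilon> (\<gamma> 0) b (c 0)"
    by blast
  then show ?thesis
    using \<chi> \<epsilon> c_nz unfolding aut_D1_def by blast
qed

lemma internal_semidirect_Aut: "internal_semidirect (d1_Aut d) (d1_Inn d) (aut_D1 d)"
proof -
  interpret G: group "d1_Aut d"
    by (rule group_Aut)
  have "id \<in> d1_shear d ` d1_P \<inter> aut_D1 d"
    using subgroup.one_closed[OF shear_subgroup] subgroup.one_closed[OF aut_D1_subgroup] by simp
  then have "d1_shear d ` d1_P \<inter> aut_D1 d = {\<one>\<^bsub>d1_Aut d\<^esub>}"
    using shear_inter_aut_D1 by auto
  moreover have "d1_shear d ` d1_P <#>\<^bsub>d1_Aut d\<^esub> aut_D1 d = carrier (d1_Aut d)"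
  proof
    show "d1_shear d ` d1_P <#>\<^bsub>d1_Aut d\<^esub> aut_D1 d \<subseteq> carrier (d1_Aut d)"
      using shear_in_Aut aut_D1_subset by (intro G.set_mult_closed) auto
    show "carrier (d1_Aut d) \<subseteq> d1_shear d ` d1_P <#>\<^bsub>d1_Aut d\<^esub> aut_D1 d"
    proof
      fix f assume f: "f \<in> carrier (d1_Aut d)"
      obtain q s a where q: "q \<in> d1_P" "s \<noteq> 0"
        "d1_shear d q (f (tD 0)) = d1_scale s (tD 0) + d1_scale a (tP 0)"
        using shear_normalizes_tD_zero[OF f] by blast
      have "d1_shear d q \<circ> f \<in> carrier (d1_Aut d)"
        using G.m_closed[OF shear_in_Aut[OF q(1)] f] by simp
      then have "d1_shear d q \<circ> f \<in> aut_D1 d"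
        using q by (intro Aut_normalized_in_aut_D1) auto
      \<comment> \<open>Undoing the normalizing shear displays \<open>f\<close> as an inner
        automorphism followed on the right by a factor from \<open>aut_D1\<close>.\<close>
      moreover have "f = d1_shear d (- q) \<circ> (d1_shear d q \<circ> f)"
        using shear_comp[of "- q" q] q(1) by (simp add: comp_assoc[symmetric])
      ultimately show "f \<in> d1_shear d ` d1_P <#>\<^bsub>d1_Aut d\<^esub> aut_D1 d"
        unfolding set_mult_def using q(1) d1_P_closed(4) by fastforce
    qed
  qed
  ultimately show ?thesis
    by (simp add: internal_semidirect_def Inn_eq shear_normal aut_D1_subgroup)
qed

end

subsection \<open>Semidirect products\<close>

text \<open>Every element factors uniquely as \<open>n \<otimes> h\<close>; the isomorphism reads
  off the two factors, and moving \<open>h\<close> past \<open>n'\<close> produces the conjugation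
  action.\<close>

lemma (in group) internal_semidirect_iso:
  assumes "internal_semidirect G N H"
  shows "G \<cong> conj_semidirect G N H"
proof -
  have N: "N \<lhd> G" and H: "subgroup H G" and NH: "N \<inter> H = {\<one>}" "N <#> H = carrier G"
    using assms by (auto simp: internal_semidirect_def)
  have subN: "subgroup N G"
    using N by (rule normal_imp_subgroup)
  have cN: "\<And>n. n \<in> N \<Longrightarrow> n \<in> carrier G" and cH: "\<And>h. h \<in> H \<Longrightarrow> h \<in> carrier G"
    using subgroup.subset[OF subN] subgroup.subset[OF H] by auto
  define \<psi> where "\<psi> = (\<lambda>(n, h). n \<otimes> h)"
  have inj: "inj_on \<psi> (N \<times> H)"
  proof (rule inj_onI, clarify)
    fix n h n' h' assume *: "n \<in> N" "h \<in> H" "n' \<in> N" "h' \<in> H" "\<psi> (n, h) = \<psi> (n', h')"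
    then have eq: "n \<otimes> h = n' \<otimes> h'"
      by (simp add: \<psi>_def)
    \<comment> \<open>The common value lies in both \<open>N\<close> and \<open>H\<close>, hence is
      the identity, which gives uniqueness of the factorization.\<close>
    have "inv n' \<otimes> n = h' \<otimes> inv h"
      using eq * cN cH by (metis inv_closed inv_solve_left inv_solve_right m_assoc m_closed)
    moreover have "inv n' \<otimes> n \<in> N" "h' \<otimes> inv h \<in> H"
      using * subN H by (simp_all add: subgroup.m_closed subgroup.m_inv_closed)
    ultimately have "inv n' \<otimes> n = \<one>" "h' \<otimes> inv h = \<one>"
      using NH(1) by auto
    then show "n = n' \<and> h = h'"
      using * cN cH by (metis inv_closed inv_equality inv_inv)
  qed
  have img: "\<psi> ` (N \<times> H) = carrier G"
    unfolding NH(2)[symmetric] by (auto simp: \<psi>_def set_mult_def)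
  have bij: "bij_betw \<psi> (N \<times> H) (carrier G)"
    using inj img by (simp add: bij_betw_def)
  define \<phi> where "\<phi> = inv_into (N \<times> H) \<psi>"
  have bij': "bij_betw \<phi> (carrier G) (N \<times> H)"
    unfolding \<phi>_def by (rule bij_betw_inv_into[OF bij])
  have \<phi>\<psi>: "\<phi> (\<psi> p) = p" if "p \<in> N \<times> H" for p
    unfolding \<phi>_def by (rule inv_into_f_f[OF inj that])
  have "\<phi> (x \<otimes> y) = \<phi> x \<otimes>\<^bsub>conj_semidirect G N H\<^esub> \<phi> y" if xy: "x \<in> carrier G" "y \<in> carrier G" for x y
  proof -
    obtain n h where x: "x = \<psi> (n, h)" "n \<in> N" "h \<in> H"
      using xy(1) unfolding img[symmetric] by blast
    obtain n' h' where y: "y = \<psi> (n', h')" "n' \<in> N" "h' \<in> H"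
      using xy(2) unfolding img[symmetric] by blast
    let ?p = "(n \<otimes> (h \<otimes> n' \<otimes> inv h), h \<otimes> h')"
    have "?p \<in> N \<times> H"
      using x y cH subN H normal_invE(2)[OF N] by (auto intro: subgroup.m_closed)
    moreover have "x \<otimes> y = \<psi> ?p"
      using x y cN cH by (simp add: \<psi>_def m_assoc inv_solve_left)
    ultimately have "\<phi> (x \<otimes> y) = ?p"
      using \<phi>\<psi> by simp
    then show ?thesis
      using x y \<phi>\<psi> by (simp add: conj_semidirect_def)
  qed
  then have "\<phi> \<in> iso G (conj_semidirect G N H)"
    using bij' by (auto simp: iso_def hom_def conj_semidirect_def dest: bij_betwE)
  then show ?thesis
    by (auto simp: is_iso_def)
qed

theorem theorem5p4:
  fixes d :: "'a::ab_group_add \<Rightarrow> 'f::field_char_0"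
  assumes nontrivial: "\<exists>x::'a. x \<noteq> 0"
    and additive: "\<And>x y. d (x + y) = d x + d y"
    and nondegenerate: "\<And>x. x \<noteq> 0 \<Longrightarrow> d x \<noteq> 0"
  shows "internal_semidirect (d1_Aut d) (d1_Inn d) (aut_D1 d) \<and>
         d1_Aut d \<cong> conj_semidirect (d1_Aut d) (d1_Inn d) (aut_D1 d)"
proof -
  interpret d1_pairing d
    using assms by unfold_locales
  show ?thesis
    using internal_semidirect_Aut group.internal_semidirect_iso[OF group_Aut internal_semidirect_Aut] by simp
qed

end
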